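(* Suppose that $1\le q<\infty$, $-\infty\le a<b\le+\infty$, $g\in L^q(a,b)$, and $\tau:(0,\infty)\to(0,\infty)$ is continuous and satisfies: if $q=1$, $\tau$ has a continuous derivative which is of constant sign; if $q>1$, the function $\tau^{q/(q-1)}$ admits a locally absolutely continuous primitive of constant sign on $(0,\infty)$. Let $h=h_{q,\tau}$, $H=H_{q,\tau}$, $G=G_{q,\tau}$ be the transforms of $\tau$ defined in the context, and let $f\in W^{2,1}_{loc}((a,b))$ be a positive solution of $$f''(x)=g(x)\tau(f(x))\quad\text{a.e. on }(a,b),$$ $$\liminf_{R\nearrow b}|f'(R)|^{2q-2}f'(R)H(f(R))-\limsup_{r\searrow a}|f'(r)|^{2q-2}f'(r)H(f(r))\le 0 .$$ Then: (i) $|f'|^{2q}h(f)\in L^1(a,b)$ and $$\int_a^b|f'(x)|^{2q}h(f(x))\,dx\le\left(\sqrt{2q-1}\right)^{2q}\int_a^b|g(x)|^q\,dx .$$ (ii) $F(x):=G(f(x))$ is H\"older continuous with exponent $\gamma=1-\frac1{2q}$ and $$\sup\left\{\frac{|F(x)-F(y)|}{|x-y|^{1-\frac1{2q}}}:x,y\in(a,b),\ x\neq y\right\}\le\sqrt{2q-1}\left(\int_a^b|g(x)|^q\,dx\right)^{\frac1{2q}} .$$ (iii) If $G$ is of constant sign and $|G|$ is strictly increasing, then for all $x,c\in(a,b)$ $$|f(x)|\le|G|^{-1}\left(|G(f(c))|+|x-c|^{1-\frac1{2q}}\sqrt{2q-1}\left(\int_a^b|g(t)|^q\,dt\right)^{\frac1{2q}}\right).$$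 In particular, when $a,b\in\mathbb{R}$, for all $x,c\in(a,b)$ $$|f(x)|\le |G|^{-1}\left(|G(f(c))|+(\max\{|c-a|,|b-c|\})^{1-\frac1{2q}}\sqrt{2q-1}\left(\int_a^b|g(t)|^q\,dt\right)^{\frac1{2q}}\right).$$ (iv) If $a\in\mathbb{R}$, $G$ is of constant sign, $|G|$ is strictly increasing and $\lim_{r\to\infty}|G(r)|=\infty$, then $f$ extends to a continuous function up to $a$ (denote this extension by $\tilde f$) and for every $x\in(a,b)$ $$|f(x)|\le|G|^{-1}\left(|G(\tilde f(a))|+|x-a|^{1-\frac1{2q}}\sqrt{2q-1}\left(\int_a^b|g(t)|^q\,dt\right)^{\frac1{2q}}\right).$$ Analogously, if $b\in\mathbb{R}$, $G$ is of constant sign, $|G|$ is strictly increasing and $\lim_{r\to\infty}|G(r)|=\infty$, then $f$ extends to a continuous function up to $b$ (denoted by $\tilde f$) and for every $x\in(a,b)$ $$|f(x)|\le|G|^{-1}\left(|G(\tilde f(b))|+|b-x|^{1-\frac1{2q}}\sqrt{2q-1}\left(\int_a^b|g(t)|^q\,dt\right)^{\frac1{2q}}\right).$$ (v) If $a\in\mathbb{R}$, $G$ is monotonic and $\tau\circ G^{-1}$ is proper (i.e. it maps bounded sets into bounded sets), then $f\in W^{2,q}(a,x)$ for any $x\in(a,b)$ and, for any choice of $c\in(a,x)$, $$\left(\int_a^x|f''(t)|^q\,dt\right)^{\frac1q}\le D_c(x)\left(\int_a^x|g(t)|^q\,dt\right)^{\frac1q},$$ where $D_c(x):=\sup\{(\tau\circ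 G^{-1})(y):y\in(-A_c(x),A_c(x))\}$ and $$A_c(x):=|(G\circ f)(c)|+|x-c|^{1-\frac1{2q}}\sqrt{2q-1}\left(\int_a^b|g(t)|^q\,dt\right)^{\frac1{2q}} .$$ In particular, if also $b\in\mathbb{R}$, then $f\in W^{2,q}(a,b)$ and, for any choice of $c\in(a,b)$, $$\left(\int_a^b|f''(t)|^q\,dt\right)^{\frac1q}\le D_c\left(\int_a^b|g(t)|^q\,dt\right)^{\frac1q},$$ where $D_c:=\sup\{(\tau\circ G^{-1})(y):y\in(-A_c,A_c)\}$ and $$A_c:=|(G\circ f)(c)|+(\max\{|c-a|,|b-c|\})^{1-\frac1{2q}}\sqrt{2q-1}\left(\int_a^b|g(t)|^q\,dt\right)^{\frac1{2q}} .$$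
   Context: Transforms of $\tau$. For $q>1$ put $k_{q,\tau}(\lambda)=\tau(\lambda)^{q/(q-1)}$ and let $K_{q,\tau}$ be a (fixed) locally absolutely continuous primitive of $k_{q,\tau}$ on $(0,\infty)$ which is of constant sign. Define, for $\lambda>0$: - $h_{q,\tau}(\lambda)=(q-1)^q|K_{q,\tau}(\lambda)|^{-q}k_{q,\tau}(\lambda)$ if $q>1$, and $h_{1,\tau}(\lambda)=|\tau'(\lambda)|/\tau(\lambda)^2$ if $q=1$; - $H_{q,\tau}(\lambda)=-(\mathrm{sgn}\,K_{q,\tau}(\lambda))(q-1)^{q-1}|K_{q,\tau}(\lambda)|^{1-q}$ if $q>1$, and $H_{1,\tau}(\lambda)=-\mathrm{sgn}(\tau'(\lambda))/\tau(\lambda)$ if $q=1$; - $G_{q,\tau}$ is a (fixed) locally absolutely continuous primitive of $(h_{q,\tau})^{1/(2q)}$ on $(0,\infty)$. "Of constant sign" means everywhere positive or everywhere negative on $(0,\infty)$. $|G|^{-1}$ and $G^{-1}$ denote the inverses of $|G|$ and $G$ on their ranges; we read $|G|^{-1}(s)=+\infty$ when $s\ge\sup|G|$, and suprema of $\tau\circ G^{-1}$ are over those $y$ lying in the range of $G$. If $\tilde f(a)=0$ (or $\tilde f(b)=0$), $G(0)$ denotes $\lim_{\lambda\searrow 0}G(\lambda)$. Here $f\in W^{2,1}_{loc}$ is identified with its $C^1$ representative whose derivative $f'$ is locally absolutely continuous; "positive" means $f>0$ on $(a,b)$.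
   Formalization: In the first half of (v), A_c(x) is taken with max{|c-a|,|x-c|} in place of |x-c|; with |x-c| alone the bound fails, e.g. q=2, τ(λ)=√λ, f(x)=1+(1-x)² on (0,1), x=1/2, c close to x. For c ≤ (a+x)/2 the two formulas agree. *)

theory Defs
  imports "HOL-Analysis.Analysis"
begin

definition constant_sign_on :: "real set \<Rightarrow> (real \<Rightarrow> real) \<Rightarrow> bool" where
  "constant_sign_on S F \<longleftrightarrow> (\<forall>x\<in>S. F x > 0) \<or> (\<forall>x\<in>S. F x < 0)"

text \<open>The pairs \<open>(u, v)\<close> below are the end points of finitely many non-overlapping compact
  subintervals of \<open>S\<close>.\<close>

definition absolutely_continuous_on :: "real set \<Rightarrow> (real \<Rightarrow> real) \<Rightarrow> bool" where
  "absolutely_continuous_on S F \<longleftrightarrow>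
     (\<forall>\<epsilon>>0. \<exists>\<delta>>0. \<forall>I :: (real \<times> real) set.
        finite I \<and> (\<forall>(u, v)\<in>I. u \<le> v \<and> {u..v} \<subseteq> S) \<and>
        pairwise (\<lambda>(u, v) (u', v'). {u<..<v} \<inter> {u'<..<v'} = {}) I \<and>
        (\<Sum>(u, v)\<in>I. v - u) < \<delta>
        \<longrightarrow> (\<Sum>(u, v)\<in>I. \<bar>F v - F u\<bar>) < \<epsilon>)"

definition locally_absolutely_continuous_on :: "real set \<Rightarrow> (real \<Rightarrow> real) \<Rightarrow> bool" where
  "locally_absolutely_continuous_on S F \<longleftrightarrow>
     (\<forall>\<alpha> \<beta>. {\<alpha>..\<beta>} \<subseteq> S \<longrightarrow> absolutely_continuous_on {\<alpha>..\<beta>} F)"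

definition ac_primitive_on :: "real set \<Rightarrow> (real \<Rightarrow> real) \<Rightarrow> (real \<Rightarrow> real) \<Rightarrow> bool" where
  "ac_primitive_on S k K \<longleftrightarrow>
     locally_absolutely_continuous_on S K \<and>
     (AE x in lebesgue. x \<in> S \<longrightarrow> (K has_real_derivative k x) (at x))"

definition Lq_on :: "real \<Rightarrow> real set \<Rightarrow> (real \<Rightarrow> real) \<Rightarrow> bool" where
  "Lq_on q S u \<longleftrightarrow>
     set_borel_measurable lebesgue S u \<and> set_integrable lebesgue S (\<lambda>x. \<bar>u x\<bar> powr q)"

text \<open>On an open interval, functions that are locally in the Sobolev space \<open>W\<^sup>2\<^sup>,\<^sup>1\<close> are identified
  with their representatives that are continuously differentiable with locally absolutely continuous derivative (continuity
  of the derivative is part of the latter); the weak second derivative is then the almost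
  everywhere defined classical one, \<open>deriv (deriv f)\<close>. Every \<open>W\<^sup>2\<^sup>,\<^sup>q\<close> function has such a
  representative.\<close>

definition W21_loc_on :: "real set \<Rightarrow> (real \<Rightarrow> real) \<Rightarrow> bool" where
  "W21_loc_on S f \<longleftrightarrow>
     (\<forall>x\<in>S. f field_differentiable (at x)) \<and> locally_absolutely_continuous_on S (deriv f)"

definition W2q_on :: "real \<Rightarrow> real set \<Rightarrow> (real \<Rightarrow> real) \<Rightarrow> bool" where
  "W2q_on q S f \<longleftrightarrow>
     W21_loc_on S f \<and> Lq_on q S f \<and> Lq_on q S (deriv f) \<and> Lq_on q S (deriv (deriv f))"

definition hoelder_continuous_on :: "real \<Rightarrow> real set \<Rightarrow> (real \<Rightarrow> real) \<Rightarrow> bool" where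
  "hoelder_continuous_on \<gamma> S F \<longleftrightarrow>
     (\<exists>C. \<forall>x\<in>S. \<forall>y\<in>S. \<bar>F x - F y\<bar> \<le> C * \<bar>x - y\<bar> powr \<gamma>)"

text \<open>The transforms of \<open>\<tau>\<close>. The primitive \<open>K\<close> of \<open>k_tr q \<tau>\<close> is a parameter; it is not used when
  \<open>q = 1\<close>.\<close>

definition k_tr :: "real \<Rightarrow> (real \<Rightarrow> real) \<Rightarrow> real \<Rightarrow> real" where
  "k_tr q \<tau> l = \<tau> l powr (q / (q - 1))"

definition h_tr :: "real \<Rightarrow> (real \<Rightarrow> real) \<Rightarrow> (real \<Rightarrow> real) \<Rightarrow> real \<Rightarrow> real" where
  "h_tr q \<tau> K l =
     (if q = 1 then \<bar>deriv \<tau> l\<bar> / (\<tau> l)^2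
      else (q - 1) powr q * \<bar>K l\<bar> powr (- q) * k_tr q \<tau> l)"

definition H_tr :: "real \<Rightarrow> (real \<Rightarrow> real) \<Rightarrow> (real \<Rightarrow> real) \<Rightarrow> real \<Rightarrow> real" where
  "H_tr q \<tau> K l =
     (if q = 1 then - sgn (deriv \<tau> l) / \<tau> l
      else - sgn (K l) * (q - 1) powr (q - 1) * \<bar>K l\<bar> powr (1 - q))"

text \<open>The inverse of \<open>\<bar>G\<bar>\<close> on its range, with value \<open>\<infinity>\<close> from the supremum of \<open>\<bar>G\<bar>\<close> on.\<close>

definition abs_inv :: "(real \<Rightarrow> real) \<Rightarrow> real \<Rightarrow> ereal" where
  "abs_inv G s =
     (if (SUP l\<in>{0<..}. ereal \<bar>G l\<bar>) \<le> ereal s then \<infinity>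
      else ereal (the_inv_into {0<..} (\<lambda>l. \<bar>G l\<bar>) s))"

definition G_ext0 :: "(real \<Rightarrow> real) \<Rightarrow> real \<Rightarrow> real" where
  "G_ext0 G l = (if l = 0 then Lim (at_right 0) G else G l)"

definition tau_G_inv :: "(real \<Rightarrow> real) \<Rightarrow> (real \<Rightarrow> real) \<Rightarrow> real \<Rightarrow> real" where
  "tau_G_inv \<tau> G = \<tau> \<circ> the_inv_into {0<..} G"

definition proper_tau_G_inv :: "(real \<Rightarrow> real) \<Rightarrow> (real \<Rightarrow> real) \<Rightarrow> bool" where
  "proper_tau_G_inv \<tau> G \<longleftrightarrow>
     (\<forall>B \<subseteq> G ` {0<..}. bounded B \<longrightarrow> bounded (tau_G_inv \<tau> G ` B))"

definition sup_tau_G_inv :: "(real \<Rightarrow> real) \<Rightarrow> (real \<Rightarrow> real) \<Rightarrow> real \<Rightarrow> real" where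
  "sup_tau_G_inv \<tau> G A = (SUP y \<in> {- A<..<A} \<inter> G ` {0<..}. tau_G_inv \<tau> G y)"

definition hoelder_const :: "real \<Rightarrow> ereal \<Rightarrow> ereal \<Rightarrow> (real \<Rightarrow> real) \<Rightarrow> real" where
  "hoelder_const q a b g =
     sqrt (2 * q - 1) * (LINT t:einterval a b|lebesgue. \<bar>g t\<bar> powr q) powr (1 / (2 * q))"

text \<open>A bound for \<open>\<bar>G (f t)\<bar>\<close> at all points \<open>t\<close> with \<open>\<bar>t - c\<bar> \<le> d\<close>, where \<open>y = G (f c)\<close>. To bound
  \<open>f''\<close> on a whole interval with end points \<open>a\<close> and \<open>x\<close> around \<open>c\<close>, the distance \<open>d\<close> has to be
  \<open>max \<bar>c - a\<bar> \<bar>x - c\<bar>\<close>; with \<open>\<bar>x - c\<bar>\<close> alone the estimate is false in general: for \<open>q = 2\<close>,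
  \<open>\<tau>(l) = sqrt l\<close>, \<open>K(l) = l\<^sup>2 / 2\<close>, \<open>G(l) = 4 sqrt 2 l powr (1/4)\<close>, \<open>f(x) = 1 + (1 - x)\<^sup>2\<close>,
  \<open>g = 2 / \<tau>(f)\<close> on the unit interval it fails at \<open>x = 1/2\<close> for \<open>c < x\<close> close to \<open>x\<close>.\<close>

definition G_bound ::
  "real \<Rightarrow> ereal \<Rightarrow> ereal \<Rightarrow> (real \<Rightarrow> real) \<Rightarrow> real \<Rightarrow> real \<Rightarrow> real" where
  "G_bound q a b g y d = \<bar>y\<bar> + d powr (1 - 1 / (2 * q)) * hoelder_const q a b g"

end

theory Submission
  imports Defs
begin

text \<open>
  The transforms are made so that, for positive \<open>l\<close>, \<open>H' = h > 0\<close>, \<open>\<tau> \<bar>H\<bar> = h powr (1 - 1/q)\<close> and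
  \<open>G' = h powr (1/(2q))\<close>. These three relations and the continuity of \<open>h\<close> are all that the argument uses.

  Put \<open>\<Phi> = \<bar>f'\<bar>\<^sup>2\<^sup>q\<^sup>-\<^sup>2 f' H(f)\<close> and \<open>E = \<bar>f'\<bar>\<^sup>2\<^sup>q h(f)\<close>. The function \<open>\<Phi>\<close> is locally absolutely continuous,
  so that its increments are the integrals of \<open>\<Phi>'\<close> (lemma \<open>absolutely_continuous_on_has_integral\<close>), and by the
  equation \<open>\<Phi>' = (2q-1) \<bar>f'\<bar>\<^sup>2\<^sup>q\<^sup>-\<^sup>2 g \<tau>(f) H(f) + E\<close> almost everywhere, where the first summand
  is at most \<open>(2q-1) \<bar>g\<bar> E powr (1 - 1/q)\<close> in absolute value. Integration over \<open>[r, R]\<close> and Hoelder's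
  inequality give, for \<open>I = \<integral>\<^sub>r\<^sup>R E\<close>,
  \<open>I \<le> \<Phi>(R) - \<Phi>(r) + (2q-1) (\<integral>\<bar>g\<bar>\<^sup>q) powr (1/q) I powr (1 - 1/q)\<close> (lemma \<open>energy_estimate\<close>).
  By the boundary condition \<open>[r, R]\<close> can be chosen to contain any given compact interval, with
  \<open>\<Phi>(R) - \<Phi>(r)\<close> at most any prescribed \<open>\<epsilon> > 0\<close> (lemma \<open>near_boundary\<close>). With \<open>C\<close> for the factor
  \<open>(2q-1) (\<integral>\<bar>g\<bar>\<^sup>q) powr (1/q)\<close>, the map \<open>t \<mapsto> t - C t powr (1 - 1/q)\<close> vanishes at \<open>C\<^sup>q\<close> and is strictly
  increasing beyond it; this forces \<open>I \<le> (2q-1)\<^sup>q \<integral>\<bar>g\<bar>\<^sup>q\<close> on every compact interval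
  (lemma \<open>energy_bound_Icc\<close>), hence on the whole interval (lemma \<open>energy_bound\<close>).

  Since \<open>(G \<circ> f)' = h(f) powr (1/(2q)) f'\<close>, whose \<open>2q\<close>-th power in absolute value is \<open>E\<close>, Hoelder's
  inequality turns the energy bound into the Hoelder estimate for \<open>G \<circ> f\<close> (lemma \<open>G_f_hoelder\<close>).
  The remaining claims are consequences of it. The pointwise bounds follow because \<open>\<bar>G\<bar>\<close> is continuous
  and increasing. At a finite end point \<open>G \<circ> f\<close> has a limit by uniform continuity. As \<open>G\<close> is an
  increasing homeomorphism onto its range and \<open>\<bar>G\<bar>\<close> is unbounded, \<open>f\<close> has a limit too, which is \<open>0\<close> if that of
  \<open>G \<circ> f\<close> is the infimum of \<open>G\<close>. Finally a bound on \<open>G \<circ> f\<close> bounds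
  \<open>\<tau>(f) = (\<tau> \<circ> G\<^sup>-\<^sup>1)(G \<circ> f)\<close>, and \<open>f'' = g \<tau>(f)\<close>.
\<close>

section \<open>Absolutely continuous functions\<close>

text \<open>The fundamental theorem of calculus for absolutely continuous functions. The gauge shrinks an interval
  with tag outside \<open>N\<close> according to differentiability at the tag, and confines an interval with tag in \<open>N\<close> to an
  open set of small measure, so that absolute continuity bounds the total increment of \<open>F\<close> over these.\<close>

lemma absolutely_continuous_on_has_integral:
  fixes F f :: "real \<Rightarrow> real"
  assumes "a \<le> b" and ac: "absolutely_continuous_on {a..b} F" and N: "negligible N"
    and der: "\<And>x. x \<in> {a..b} - N \<Longrightarrow> (F has_vector_derivative f x) (at x within {a..b})"
  shows "(f has_integral F b - F a) {a..b}"
proof (cases "a = b")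
  case True
  then show ?thesis by auto
next
  case False
  with \<open>a \<le> b\<close> have "a < b" by simp
  define f0 where "f0 x = (if x \<in> N then 0 else f x)" for x
  have "(f0 has_integral F b - F a) (cbox a b)"
    unfolding has_integral_factor_content
  proof (intro allI impI)
    fix e :: real assume "e > 0"
    have "e * (b - a) / 2 > 0" using \<open>a < b\<close> \<open>e > 0\<close> by simp
    then obtain \<delta> where "\<delta> > 0" and \<delta>: "\<forall>I :: (real \<times> real) set.
        finite I \<and> (\<forall>(u, v)\<in>I. u \<le> v \<and> {u..v} \<subseteq> {a..b}) \<and>
        pairwise (\<lambda>(u, v) (u', v'). {u<..<v} \<inter> {u'<..<v'} = {}) I \<and>
        (\<Sum>(u, v)\<in>I. v - u) < \<delta> \<longrightarrow> (\<Sum>(u, v)\<in>I. \<bar>F v - F u\<bar>) < e * (b - a) / 2"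
      using ac[unfolded absolutely_continuous_on_def, rule_format] by blast
    obtain U where U: "open U" "N \<subseteq> U" "U - N \<in> lmeasurable" "emeasure lebesgue (U - N) < ennreal \<delta>"
      using sets_lebesgue_outer_open[OF negligible_imp_sets[OF N] \<open>\<delta> > 0\<close>] by blast
    have Ueq: "U = (U - N) \<union> N" using U by auto
    have Um: "U \<in> lmeasurable"
      using U(3) N negligible_imp_measurable fmeasurable.Un Ueq by metis
    have "measure lebesgue U \<le> measure lebesgue (U - N) + measure lebesgue N"
      using U(3) N negligible_imp_sets
      by (subst Ueq, intro measure_Un_le) (auto intro: fmeasurableD)
    also have "\<dots> < \<delta>"
      using U(3,4) N \<open>\<delta> > 0\<close> by (simp add: negligible_imp_measure0 emeasure_eq_measure2 ennreal_less_iff)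
    finally have U\<delta>: "measure lebesgue U < \<delta>" .
    have "\<exists>r>0. \<forall>y\<in>{a..b}. norm (y - x) < r \<longrightarrow>
       norm (F y - F x - (y - x) *\<^sub>R f x) \<le> e / 2 * norm (y - x)" if "x \<in> {a..b} - N" for x
      using der[OF that, unfolded has_vector_derivative_def has_derivative_within_alt] half_gt_zero[OF \<open>e > 0\<close>]
      by blast
    then obtain r where r: "\<And>x. x \<in> {a..b} - N \<Longrightarrow> r x > 0"
      "\<And>x y. x \<in> {a..b} - N \<Longrightarrow> y \<in> {a..b} \<Longrightarrow> norm (y - x) < r x \<Longrightarrow>
       norm (F y - F x - (y - x) *\<^sub>R f x) \<le> e / 2 * norm (y - x)" by metis
    define d where "d x = (if x \<in> N then U else if x \<in> {a..b} then ball x (r x) else UNIV)" for x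
    have gd: "gauge d" unfolding gauge_def d_def using U r by auto
    have main: "norm ((\<Sum>(x, k)\<in>p. measure lborel k *\<^sub>R f0 x) - (F b - F a)) \<le> e * measure lborel (cbox a b)"
      if p: "p tagged_division_of cbox a b" and fine: "d fine p" for p
    proof -
      note pD = tagged_division_ofD[OF p]
      have cell: "\<exists>u v. K = {u..v} \<and> u \<le> v \<and> u \<le> x \<and> x \<le> v \<and> a \<le> u \<and> v \<le> b \<and> Inf K = u \<and> Sup K = v
         \<and> measure lborel K = v - u" if xK: "(x,K) \<in> p" for x K
      proof -
        obtain u v where "K = {u..v}" using pD(4)[OF xK] by auto
        moreover have "x \<in> K" "K \<subseteq> {a..b}" using pD(2,3)[OF xK] by auto
        ultimately show ?thesis by (auto intro!: exI[of _ u] exI[of _ v])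
      qed
      \<comment> \<open>The nondegenerate intervals with tag in \<open>N\<close>. Degenerate ones contribute nothing, but would make
        the map \<open>J\<close> to the pairs of end points non-injective.\<close>
      define P where "P = {(x,K) \<in> p. x \<in> N \<and> Inf K < Sup K}"
      have "finite P" using pD(1) by (auto simp: P_def intro: finite_subset[of _ p])
      have Pp: "P \<subseteq> p" by (auto simp: P_def)
      define J where "J = (\<lambda>(x::real,K::real set). (Inf K, Sup K))"
      have ne: "interior K \<inter> interior K' = {}" if "(x,K) \<in> p" "(x',K') \<in> p" "(x,K) \<noteq> (x',K')" for x K x' K'
        using pD(5) that by blast
      have inj: "inj_on J P"
      proof (rule inj_onI, clarify)
        fix x K x' K' assume *: "(x,K) \<in> P" "(x',K') \<in> P" "J (x,K) = J (x',K')"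
        then have "(x,K) \<in> p" "(x',K') \<in> p" "Inf K < Sup K" "Inf K = Inf K'" "Sup K = Sup K'"
          by (auto simp: P_def J_def)
        moreover from this have "K = {Inf K..Sup K}" "K' = {Inf K'..Sup K'}" using cell by blast+
        ultimately have "K' = K" "interior K \<noteq> {}"
          by (metis, metis interior_atLeastAtMost_real greaterThanLessThan_empty_iff not_le)
        then show "x = x' \<and> K = K'" using ne \<open>(x,K) \<in> p\<close> \<open>(x',K') \<in> p\<close> by blast
      qed
      have PI: "(\<Sum>(x,K)\<in>P. \<bar>F (Sup K) - F (Inf K)\<bar>) < e * (b - a) / 2"
      proof -
        have "(\<Sum>(u,v)\<in>J ` P. \<bar>F v - F u\<bar>) < e * (b - a) / 2"
        proof (rule \<delta>[rule_format], intro conjI)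
          show "finite (J ` P)" using \<open>finite P\<close> by simp
          show "\<forall>(u, v)\<in>J ` P. u \<le> v \<and> {u..v} \<subseteq> {a..b}"
            using Pp cell by (fastforce simp: J_def)
          have JK: "{u<..<v} = interior K" if "(x,K) \<in> p" "J (x,K) = (u,v)" for x K u v
          proof -
            obtain u' v' where "K = {u'..v'}" "Inf K = u'" "Sup K = v'" using cell[OF \<open>(x,K) \<in> p\<close>] by blast
            then show ?thesis using that by (simp add: J_def)
          qed
          show "pairwise (\<lambda>(u, v) (u', v'). {u<..<v} \<inter> {u'<..<v'} = {}) (J ` P)"
          proof (rule pairwiseI)
            fix z z' assume z: "z \<in> J ` P" "z' \<in> J ` P" "z \<noteq> z'"
            then obtain x K x' K' where *: "(x,K) \<in> P" "(x',K') \<in> P" "z = J (x,K)" "z' = J (x',K')"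
              by auto
            obtain u v u' v' where uv: "z = (u,v)" "z' = (u',v')" by fastforce
            have "interior K \<inter> interior K' = {}" using ne[of x K x' K'] Pp z * by auto
            moreover have "{u<..<v} = interior K" "{u'<..<v'} = interior K'"
              using * uv Pp by (metis JK subsetD)+
            ultimately show "(\<lambda>(u, v) (u', v'). {u<..<v} \<inter> {u'<..<v'} = {}) z z'" using uv by (simp only: prod.case)
          qed
          have snd_meas: "snd z \<in> lmeasurable" if z: "z \<in> P" for z
          proof -
            obtain x K where xK: "z = (x,K)" by fastforce
            then obtain u v where "K = {u..v}" using z Pp cell by (meson subsetD)
            then show ?thesis using xK by simp
          qed
          have "(\<Sum>(u, v)\<in>J ` P. v - u) = (\<Sum>z\<in>P. measure lebesgue (snd z))"
            unfolding sum.reindex[OF inj]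
          proof (rule sum.cong[OF refl])
            fix z assume z: "z \<in> P"
            obtain x K where xK: "z = (x,K)" by fastforce
            then obtain u v where "K = {u..v}" "u \<le> v" using z Pp cell by (meson subsetD)
            then show "((\<lambda>(u, v). v - u) \<circ> J) z = measure lebesgue (snd z)" using xK by (simp add: J_def)
          qed
          also have "\<dots> = measure lebesgue (\<Union>(snd ` P))"
          proof (rule measure_negligible_finite_Union_image[symmetric])
            show "finite P" by fact
            show "snd z \<in> lmeasurable" if "z \<in> P" for z using snd_meas[OF that] .
            show "pairwise (\<lambda>x y. negligible (snd x \<inter> snd y)) P"
            proof (rule pairwiseI)
              fix z z' assume z: "z \<in> P" "z' \<in> P" "z \<noteq> z'"
              obtain x K x' K' where *: "z = (x,K)" "z' = (x',K')" by fastforce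
              then have "interior (K \<inter> K') = {}" using ne[of x K x' K'] z Pp by auto
              moreover obtain u v u' v' where "K = {u..v}" "K' = {u'..v'}" using * z Pp cell by (meson subsetD)
              ultimately show "negligible (snd z \<inter> snd z')"
                using * by (simp add: negligible_convex_interior)
            qed
          qed
          also have "\<dots> \<le> measure lebesgue U"
          proof (rule measure_mono_fmeasurable)
            show "\<Union>(snd ` P) \<subseteq> U"
              using fine by (fastforce simp: P_def fine_def d_def)
            show "\<Union>(snd ` P) \<in> sets lebesgue"
              using \<open>finite P\<close> snd_meas by (intro sets.finite_UN) (auto dest: fmeasurableD)
          qed fact
          finally show "(\<Sum>(u, v)\<in>J ` P. v - u) < \<delta>" using U\<delta> by simp
        qed
        moreover have "(\<Sum>(u,v)\<in>J ` P. \<bar>F v - F u\<bar>) = (\<Sum>(x,K)\<in>P. \<bar>F (Sup K) - F (Inf K)\<bar>)"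
          unfolding sum.reindex[OF inj] by (simp add: J_def case_prod_unfold)
        ultimately show ?thesis by simp
      qed
      have tel: "b - a = (\<Sum>(x,K)\<in>p. Sup K - Inf K)" "F b - F a = (\<Sum>(x,K)\<in>p. F(Sup K) - F(Inf K))"
        using additive_tagged_division_1[where f= "\<lambda>x. x"] additive_tagged_division_1[where f= F] \<open>a \<le> b\<close> p by auto
      have "norm ((\<Sum>(x, k)\<in>p. measure lborel k *\<^sub>R f0 x) - (F b - F a))
          = norm (\<Sum>(x,K)\<in>p. measure lborel K *\<^sub>R f0 x - (F (Sup K) - F (Inf K)))"
        unfolding tel sum_subtractf[symmetric] by (simp add: case_prod_unfold)
      also have "\<dots> \<le> (\<Sum>(x,K)\<in>p. e / 2 * (Sup K - Inf K) + (if (x,K) \<in> P then \<bar>F (Sup K) - F (Inf K)\<bar> else 0))"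
      proof (rule sum_norm_le, clarify)
        fix x K assume xK: "(x,K) \<in> p"
        obtain u v where uv: "K = {u..v}" "u \<le> x" "x \<le> v" "a \<le> u" "v \<le> b" "Inf K = u" "Sup K = v" "measure lborel K = v - u"
          using cell[OF xK] by blast
        show "norm (measure lborel K *\<^sub>R f0 x - (F (Sup K) - F (Inf K)))
          \<le> e / 2 * (Sup K - Inf K) + (if (x,K) \<in> P then \<bar>F (Sup K) - F (Inf K)\<bar> else 0)"
        proof (cases "x \<in> N")
          case True
          have "f0 x = 0" using True by (simp add: f0_def)
          moreover have "0 \<le> e / 2 * (v - u)" using uv \<open>e > 0\<close> by simp
          moreover have "u = v" if "(x,K) \<notin> P" using that xK uv(1-3,6,7) True by (auto simp: P_def)
          ultimately show ?thesis unfolding uv(6,7) by (cases "(x,K) \<in> P") (simp, simp)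
        next
          case False
          have xab: "x \<in> {a..b} - N" using uv False by auto
          have "K \<subseteq> ball x (r x)" using fineD[OF fine xK] False xab by (simp add: d_def)
          moreover have "u \<in> K" "v \<in> K" using uv(1-3) by auto
          ultimately have "u \<in> ball x (r x)" "v \<in> ball x (r x)" by blast+
          then have uB: "\<bar>u - x\<bar> < r x" and vB: "\<bar>v - x\<bar> < r x" by (auto simp: dist_real_def)
          have "\<bar>F u - F x - (u - x) * f x\<bar> \<le> e / 2 * \<bar>u - x\<bar>"
            using r(2)[OF xab, of u] uB uv by simp
          moreover have "\<bar>F v - F x - (v - x) * f x\<bar> \<le> e / 2 * \<bar>v - x\<bar>"
            using r(2)[OF xab, of v] vB uv by simp
          moreover have "e / 2 * \<bar>u - x\<bar> + e / 2 * \<bar>v - x\<bar> = e / 2 * (v - u)"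
            using uv(2,3) by (simp add: field_simps)
          moreover have "(v - u) * f x - (F v - F u) = (F u - F x - (u - x) * f x) - (F v - F x - (v - x) * f x)"
            by (simp add: algebra_simps)
          ultimately have "\<bar>(v - u) * f x - (F v - F u)\<bar> \<le> e / 2 * (v - u)" by linarith
          then show ?thesis using False uv by (simp add: f0_def P_def)
        qed
      qed
      also have "\<dots> = e / 2 * (b - a) + (\<Sum>(x,K)\<in>p. if (x,K) \<in> P then \<bar>F (Sup K) - F (Inf K)\<bar> else 0)"
        unfolding tel by (simp add: case_prod_unfold sum.distrib sum_distrib_left)
      also have "(\<Sum>(x,K)\<in>p. if (x,K) \<in> P then \<bar>F (Sup K) - F (Inf K)\<bar> else 0) = (\<Sum>(x,K)\<in>P. \<bar>F (Sup K) - F (Inf K)\<bar>)"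
        using pD(1) Pp by (intro sum.mono_neutral_cong_right) auto
      finally have "norm ((\<Sum>(x, k)\<in>p. measure lborel k *\<^sub>R f0 x) - (F b - F a)) \<le> e / 2 * (b - a) + e * (b - a) / 2"
        using PI by linarith
      also have "\<dots> = e * measure lborel (cbox a b)" using \<open>a < b\<close> by (simp add: field_simps)
      finally show ?thesis .
    qed
    show "\<exists>\<gamma>. gauge \<gamma> \<and> (\<forall>p. p tagged_division_of cbox a b \<and> \<gamma> fine p \<longrightarrow>
        norm ((\<Sum>(x, k)\<in>p. measure lborel k *\<^sub>R f0 x) - (F b - F a)) \<le> e * measure lborel (cbox a b))"
      by (rule exI[of _ d], intro conjI allI impI, rule gd, rule main) auto
  qed
  then have "(f0 has_integral F b - F a) {a..b}" by simp
  then show ?thesis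
    by (rule has_integral_spike[OF N, rotated]) (auto simp: f0_def)
qed

lemma absolutely_continuous_on_imp_continuous_on:
  assumes "absolutely_continuous_on {a..b} F"
  shows "continuous_on {a..b} F"
  unfolding continuous_on_iff
proof (intro ballI allI impI)
  fix x e :: real assume x: "x \<in> {a..b}" and "e > 0"
  obtain \<delta> where "\<delta> > 0" and \<delta>: "\<forall>I :: (real \<times> real) set.
      finite I \<and> (\<forall>(u, v)\<in>I. u \<le> v \<and> {u..v} \<subseteq> {a..b}) \<and>
      pairwise (\<lambda>(u, v) (u', v'). {u<..<v} \<inter> {u'<..<v'} = {}) I \<and>
      (\<Sum>(u, v)\<in>I. v - u) < \<delta> \<longrightarrow> (\<Sum>(u, v)\<in>I. \<bar>F v - F u\<bar>) < e"
    using assms[unfolded absolutely_continuous_on_def, rule_format, OF \<open>e > 0\<close>] by blast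
  have *: "\<bar>F v - F u\<bar> < e" if "u \<le> v" "u \<in> {a..b}" "v \<in> {a..b}" "v - u < \<delta>" for u v
    using \<delta>[rule_format, of "{(u,v)}"] that by (auto simp: pairwise_def)
  have "dist (F y) (F x) < e" if "y \<in> {a..b}" "dist y x < \<delta>" for y
    using *[of x y] *[of y x] that x by (cases "x \<le> y") (auto simp: dist_real_def abs_minus_commute)
  then show "\<exists>d>0. \<forall>x'\<in>{a..b}. dist x' x < d \<longrightarrow> dist (F x') (F x) < e"
    using \<open>\<delta> > 0\<close> by blast
qed

lemma locally_absolutely_continuous_on_imp_continuous_on:
  assumes "locally_absolutely_continuous_on S F" "open S"
  shows "continuous_on S F"
proof (rule continuous_at_imp_continuous_on, rule ballI)
  fix x assume "x \<in> S"
  then obtain e where "e > 0" "cball x e \<subseteq> S" using \<open>open S\<close> open_contains_cball by blast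
  then have "{x - e..x + e} \<subseteq> S" by (simp add: cball_eq_atLeastAtMost)
  then have "continuous_on {x - e..x + e} F"
    using assms(1) absolutely_continuous_on_imp_continuous_on
    by (auto simp: locally_absolutely_continuous_on_def)
  then show "isCont F x" using \<open>e > 0\<close> by (intro continuous_on_interior[of "{x-e..x+e}"]) auto
qed

text \<open>Products and compositions of an absolutely continuous \<open>F\<close> with locally Lipschitz functions have
  the following form.\<close>

lemma absolutely_continuous_on_lipschitz_comb:
  fixes F \<Phi> :: "real \<Rightarrow> real"
  assumes ac: "absolutely_continuous_on {a..b} F" and "L \<ge> 0"
    and L: "\<And>u v. u \<in> {a..b} \<Longrightarrow> v \<in> {a..b} \<Longrightarrow> \<bar>\<Phi> v - \<Phi> u\<bar> \<le> L * (\<bar>F v - F u\<bar> + \<bar>v - u\<bar>)"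
  shows "absolutely_continuous_on {a..b} \<Phi>"
  unfolding absolutely_continuous_on_def
proof (intro allI impI)
  fix e :: real assume "e > 0"
  define e' where "e' = e / (L + 1) / 2"
  have "e' > 0" using \<open>e > 0\<close> \<open>L \<ge> 0\<close> by (simp add: e'_def)
  then obtain \<delta> where "\<delta> > 0" and \<delta>: "\<forall>I :: (real \<times> real) set.
      finite I \<and> (\<forall>(u, v)\<in>I. u \<le> v \<and> {u..v} \<subseteq> {a..b}) \<and>
      pairwise (\<lambda>(u, v) (u', v'). {u<..<v} \<inter> {u'<..<v'} = {}) I \<and>
      (\<Sum>(u, v)\<in>I. v - u) < \<delta> \<longrightarrow> (\<Sum>(u, v)\<in>I. \<bar>F v - F u\<bar>) < e'"
    using ac[unfolded absolutely_continuous_on_def, rule_format, OF \<open>e' > 0\<close>] by blast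
  show "\<exists>\<delta>>0. \<forall>I :: (real \<times> real) set.
      finite I \<and> (\<forall>(u, v)\<in>I. u \<le> v \<and> {u..v} \<subseteq> {a..b}) \<and>
      pairwise (\<lambda>(u, v) (u', v'). {u<..<v} \<inter> {u'<..<v'} = {}) I \<and>
      (\<Sum>(u, v)\<in>I. v - u) < \<delta> \<longrightarrow> (\<Sum>(u, v)\<in>I. \<bar>\<Phi> v - \<Phi> u\<bar>) < e"
  proof (intro exI[of _ "min \<delta> e'"] conjI allI impI)
    show "0 < min \<delta> e'" using \<open>\<delta> > 0\<close> \<open>e' > 0\<close> by simp
    fix I :: "(real \<times> real) set"
    assume I: "finite I \<and> (\<forall>(u, v)\<in>I. u \<le> v \<and> {u..v} \<subseteq> {a..b}) \<and>
      pairwise (\<lambda>(u, v) (u', v'). {u<..<v} \<inter> {u'<..<v'} = {}) I \<and>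
      (\<Sum>(u, v)\<in>I. v - u) < min \<delta> e'"
    then have F: "(\<Sum>(u, v)\<in>I. \<bar>F v - F u\<bar>) < e'" using \<delta>[rule_format, of I] by linarith
    have "(\<Sum>(u, v)\<in>I. \<bar>\<Phi> v - \<Phi> u\<bar>) \<le> (\<Sum>(u, v)\<in>I. L * (\<bar>F v - F u\<bar> + (v - u)))"
    proof (rule sum_mono)
      fix z assume z: "z \<in> I"
      obtain u v where uv: "z = (u,v)" by fastforce
      then have "u \<le> v" "{u..v} \<subseteq> {a..b}" using z I by auto
      then have "\<bar>\<Phi> v - \<Phi> u\<bar> \<le> L * (\<bar>F v - F u\<bar> + \<bar>v - u\<bar>)" by (intro L) auto
      then show "(case z of (u, v) \<Rightarrow> \<bar>\<Phi> v - \<Phi> u\<bar>) \<le> (case z of (u, v) \<Rightarrow> L * (\<bar>F v - F u\<bar> + (v - u)))"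
        using uv \<open>u \<le> v\<close> by simp
    qed
    also have "\<dots> = L * ((\<Sum>(u, v)\<in>I. \<bar>F v - F u\<bar>) + (\<Sum>(u, v)\<in>I. v - u))"
      by (simp add: sum_distrib_left[symmetric] sum.distrib[symmetric] case_prod_unfold)
    also have "\<dots> \<le> L * (e' + e')" using F I \<open>L \<ge> 0\<close> by (intro mult_left_mono) auto
    also have "\<dots> < (L + 1) * (e' + e')" using \<open>e' > 0\<close> by (intro mult_strict_right_mono) auto
    also have "e' + e' = e / (L + 1)" unfolding e'_def by (rule field_sum_of_halves)
    also have "(L + 1) * (e / (L + 1)) = e" using \<open>L \<ge> 0\<close> by simp
    finally show "(\<Sum>(u, v)\<in>I. \<bar>\<Phi> v - \<Phi> u\<bar>) < e" .
  qed
qed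

lemma C1_imp_lipschitz:
  fixes F F' :: "real \<Rightarrow> real"
  assumes der: "\<And>x. x \<in> {a..b} \<Longrightarrow> (F has_real_derivative F' x) (at x)"
    and cont: "continuous_on {a..b} F'"
  obtains L where "L \<ge> 0" "\<And>u v. u \<in> {a..b} \<Longrightarrow> v \<in> {a..b} \<Longrightarrow> \<bar>F v - F u\<bar> \<le> L * \<bar>v - u\<bar>"
proof -
  have "bounded (F' ` {a..b})" using cont compact_continuous_image compact_imp_bounded by blast
  then obtain L where L: "L > 0" "\<And>x. x \<in> {a..b} \<Longrightarrow> \<bar>F' x\<bar> \<le> L"
    unfolding bounded_pos by auto
  have "\<bar>F v - F u\<bar> \<le> L * \<bar>v - u\<bar>" if "u \<in> {a..b}" "v \<in> {a..b}" for u v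
    using field_differentiable_bound[of "{a..b}" F F' L v u] der L that
    by (auto intro: has_field_derivative_at_within)
  with L(1) show ?thesis by (intro that[of L]) auto
qed

text \<open>A primitive in the almost everywhere sense of a continuous function is a classical primitive.\<close>

lemma ac_primitive_on_continuous_imp_DERIV:
  fixes k K :: "real \<Rightarrow> real"
  assumes prim: "ac_primitive_on S k K" and "open S" and cont: "continuous_on S k" and "x \<in> S"
  shows "(K has_real_derivative k x) (at x)"
proof -
  obtain e where "e > 0" and e: "cball x e \<subseteq> S"
    using \<open>open S\<close> \<open>x \<in> S\<close> open_contains_cball by blast
  define u v where "u = x - e" and "v = x + e"
  have uv: "{u..v} \<subseteq> S" "u < x" "x < v" using e \<open>e > 0\<close> by (auto simp: u_def v_def cball_eq_atLeastAtMost)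
  have ac: "locally_absolutely_continuous_on S K"
    and ae: "AE x in lebesgue. x \<in> S \<longrightarrow> (K has_real_derivative k x) (at x)"
    using prim by (auto simp: ac_primitive_on_def)
  obtain N where N: "N \<in> null_sets lebesgue" "{x. \<not> (x \<in> S \<longrightarrow> (K has_real_derivative k x) (at x))} \<subseteq> N"
    using ae by (auto simp: eventually_ae_filter)
  have int: "(k has_integral K y - K u) {u..y}" if "y \<in> {u..v}" for y
  proof (rule absolutely_continuous_on_has_integral)
    show "negligible N" using N by (simp add: negligible_iff_null_sets)
    show "absolutely_continuous_on {u..y} K"
      using ac uv(1) that unfolding locally_absolutely_continuous_on_def by (meson atLeastatMost_subset_iff order_trans order_refl atLeastAtMost_iff)
    show "(K has_vector_derivative k z) (at z within {u..y})" if "z \<in> {u..y} - N" for z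
    proof -
      have "z \<in> S" using that uv(1) \<open>y \<in> {u..v}\<close> by auto
      then have "(K has_real_derivative k z) (at z)" using N(2) that by blast
      then show ?thesis by (simp add: has_real_derivative_iff_has_vector_derivative has_vector_derivative_at_within)
    qed
  qed (use that in auto)
  have "((\<lambda>y. integral {u..y} k) has_real_derivative k x) (at x within {u..v})"
    using uv cont by (intro integral_has_real_derivative) (auto intro: continuous_on_subset)
  then have "((\<lambda>y. K u + integral {u..y} k) has_real_derivative k x) (at x within {u..v})"
    by (auto intro!: derivative_eq_intros)
  then have "(K has_real_derivative k x) (at x within {u..v})"
    unfolding has_field_derivative_def
    by (rule has_derivative_transform[rotated 2]) (use uv integral_unique[OF int] in auto)
  then show ?thesis using uv at_within_Icc_at by metis
qed

section \<open>Integral inequalities\<close>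

lemma set_borel_measurable_continuous:
  fixes w :: "real \<Rightarrow> real"
  assumes "continuous_on A w" "A \<in> sets borel"
  shows "set_borel_measurable lebesgue A w"
  using set_measurable_continuous_on[OF assms(2,1)] unfolding set_borel_measurable_def
  by (intro measurable_completion) simp

lemma set_integral_mono_set:
  fixes w :: "'a \<Rightarrow> real"
  assumes "set_integrable M B w" "A \<in> sets M" "A \<subseteq> B" "\<And>x. x \<in> B \<Longrightarrow> 0 \<le> w x"
  shows "(LINT x:A|M. w x) \<le> (LINT x:B|M. w x)"
  unfolding set_lebesgue_integral_def
proof (rule integral_mono)
  show "integrable M (\<lambda>x. indicator A x *\<^sub>R w x)"
    using set_integrable_subset[OF assms(1-3)] by (simp add: set_integrable_def)
  show "integrable M (\<lambda>x. indicator B x *\<^sub>R w x)"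
    using assms(1) by (simp add: set_integrable_def)
  show "indicator A x *\<^sub>R w x \<le> indicator B x *\<^sub>R w x" for x
    using assms(3,4) by (auto simp: indicator_def)
qed

lemma Lq_on_bounded:
  assumes q: "0 < q" and cont: "continuous_on {u<..<v} w" and bnd: "\<And>x. x \<in> {u<..<v} \<Longrightarrow> \<bar>w x\<bar> \<le> B"
  shows "Lq_on q {u<..<v} w"
proof -
  have "set_integrable lebesgue {u<..<v} (\<lambda>x. \<bar>w x\<bar> powr q)"
  proof (rule set_integrable_bound)
    show "set_integrable lebesgue {u<..<v} (\<lambda>x. B powr q)"
      using lmeasurable_interval(2)[of u v]
      by (auto simp: set_integrable_def fmeasurable_def intro!: integrable_mult_left integrable_real_indicator)
    have "continuous_on {u<..<v} (\<lambda>x. \<bar>w x\<bar> powr q)"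
      using q by (intro continuous_on_powr' continuous_intros cont) auto
    then show "set_borel_measurable lebesgue {u<..<v} (\<lambda>x. \<bar>w x\<bar> powr q)"
      by (rule set_borel_measurable_continuous) simp
    show "AE x in lebesgue. x \<in> {u<..<v} \<longrightarrow> norm (\<bar>w x\<bar> powr q) \<le> norm (B powr q)"
      using bnd q by (auto intro!: powr_mono2)
  qed
  then show ?thesis
    using set_borel_measurable_continuous[OF cont] by (simp add: Lq_on_def)
qed

lemma Hoelder_inequality_integral:
  fixes u v :: "'a \<Rightarrow> real"
  assumes p: "1 < p" "1 < p'" "1 / p + 1 / p' = 1"
    and u: "u \<in> borel_measurable M" "integrable M (\<lambda>x. \<bar>u x\<bar> powr p)"
    and v: "v \<in> borel_measurable M" "integrable M (\<lambda>x. \<bar>v x\<bar> powr p')"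
  shows "integrable M (\<lambda>x. \<bar>u x * v x\<bar>)" (is ?int)
    and "(LINT x|M. \<bar>u x * v x\<bar>)
      \<le> (LINT x|M. \<bar>u x\<bar> powr p) powr (1 / p) * (LINT x|M. \<bar>v x\<bar> powr p') powr (1 / p')" (is ?le)
proof -
  define A where "A = (LINT x|M. \<bar>u x\<bar> powr p)"
  define B where "B = (LINT x|M. \<bar>v x\<bar> powr p')"
  have AB: "A \<ge> 0" "B \<ge> 0" by (auto simp: A_def B_def)
  have zero: ?int ?le if "AE x in M. u x * v x = 0"
  proof -
    have eq: "AE x in M. \<bar>u x * v x\<bar> = 0" using that by simp
    have "integrable M (\<lambda>x. \<bar>u x * v x\<bar>) \<longleftrightarrow> integrable M (\<lambda>x. 0 :: real)"
      using u v eq by (intro integrable_cong_AE) auto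
    then show ?int by simp
    have "(LINT x|M. \<bar>u x * v x\<bar>) = (LINT x|M. 0)"
      using u v eq by (intro integral_cong_AE) auto
    then show ?le by simp
  qed
  have "?int \<and> ?le"
  proof (cases "A = 0 \<or> B = 0")
    case True
    then have "AE x in M. u x * v x = 0"
    proof
      assume "A = 0"
      then have "AE x in M. \<bar>u x\<bar> powr p = 0"
        using u integral_nonneg_eq_0_iff_AE[of M "\<lambda>x. \<bar>u x\<bar> powr p"] by (simp add: A_def)
      then show ?thesis by (rule AE_mp) auto
    next
      assume "B = 0"
      then have "AE x in M. \<bar>v x\<bar> powr p' = 0"
        using v integral_nonneg_eq_0_iff_AE[of M "\<lambda>x. \<bar>v x\<bar> powr p'"] by (simp add: B_def)
      then show ?thesis by (rule AE_mp) auto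
    qed
    then show ?thesis using zero by blast
  next
    case False
    with AB have "A > 0" "B > 0" by auto
    define c where "c = A powr (1 / p) * B powr (1 / p')"
    have "c > 0" using \<open>A > 0\<close> \<open>B > 0\<close> by (simp add: c_def)
    \<comment> \<open>Young's inequality for the normalised factors.\<close>
    have pw: "\<bar>u x * v x\<bar> \<le> c * (\<bar>u x\<bar> powr p / (A * p) + \<bar>v x\<bar> powr p' / (B * p'))" for x
    proof -
      have "(\<bar>u x\<bar> / A powr (1 / p)) * (\<bar>v x\<bar> / B powr (1 / p'))
          \<le> (\<bar>u x\<bar> / A powr (1 / p)) powr p / p + (\<bar>v x\<bar> / B powr (1 / p')) powr p' / p'"
        using p by (intro Youngs_inequality) auto
      also have "\<dots> = \<bar>u x\<bar> powr p / (A * p) + \<bar>v x\<bar> powr p' / (B * p')"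
        using p \<open>A > 0\<close> \<open>B > 0\<close> by (simp add: powr_divide powr_powr)
      finally have "\<bar>u x\<bar> * \<bar>v x\<bar> / c \<le> \<bar>u x\<bar> powr p / (A * p) + \<bar>v x\<bar> powr p' / (B * p')"
        by (simp add: c_def)
      then show ?thesis using \<open>c > 0\<close> by (simp add: abs_mult pos_divide_le_eq mult.commute)
    qed
    have int: "integrable M (\<lambda>x. c * (\<bar>u x\<bar> powr p / (A * p) + \<bar>v x\<bar> powr p' / (B * p')))"
      using u v by simp
    have I: ?int
      by (rule Bochner_Integration.integrable_bound[OF int])
        (use u v pw order_trans[OF pw abs_ge_self] in auto)
    have "(LINT x|M. \<bar>u x * v x\<bar>) \<le> (LINT x|M. c * (\<bar>u x\<bar> powr p / (A * p) + \<bar>v x\<bar> powr p' / (B * p')))"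
      by (rule integral_mono[OF I int pw])
    also have "\<dots> = c * (A / (A * p) + B / (B * p'))"
      using u v by (simp add: A_def B_def)
    also have "\<dots> = c" using \<open>A > 0\<close> \<open>B > 0\<close> p by simp
    finally show ?thesis using I by (simp add: c_def A_def B_def)
  qed
  then show ?int ?le by auto
qed

lemma Hoelder_inequality_set_integral:
  fixes u v :: "'a \<Rightarrow> real"
  assumes p: "1 < p" "1 < p'" "1 / p + 1 / p' = 1"
    and u: "set_borel_measurable M S u" "set_integrable M S (\<lambda>x. \<bar>u x\<bar> powr p)"
    and v: "set_borel_measurable M S v" "set_integrable M S (\<lambda>x. \<bar>v x\<bar> powr p')"
  shows "set_integrable M S (\<lambda>x. \<bar>u x * v x\<bar>)"
    and "(LINT x:S|M. \<bar>u x * v x\<bar>)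
      \<le> (LINT x:S|M. \<bar>u x\<bar> powr p) powr (1 / p) * (LINT x:S|M. \<bar>v x\<bar> powr p') powr (1 / p')"
proof -
  have 1: "\<bar>indicator S x *\<^sub>R w x\<bar> powr r = indicator S x *\<^sub>R (\<bar>w x\<bar> powr r)" for x r and w :: "'a \<Rightarrow> real"
    by (simp add: indicator_def)
  have 2: "\<bar>(indicator S x *\<^sub>R u x) * (indicator S x *\<^sub>R v x)\<bar> = indicator S x *\<^sub>R \<bar>u x * v x\<bar>" for x
    by (simp add: indicator_def)
  note H = Hoelder_inequality_integral[OF p, of "\<lambda>x. indicator S x *\<^sub>R u x" M "\<lambda>x. indicator S x *\<^sub>R v x", unfolded 1 2]
  show "set_integrable M S (\<lambda>x. \<bar>u x * v x\<bar>)"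
    using H(1) u v unfolding set_integrable_def set_borel_measurable_def by blast
  show "(LINT x:S|M. \<bar>u x * v x\<bar>)
      \<le> (LINT x:S|M. \<bar>u x\<bar> powr p) powr (1 / p) * (LINT x:S|M. \<bar>v x\<bar> powr p') powr (1 / p')"
    using H(2) u v unfolding set_integrable_def set_borel_measurable_def set_lebesgue_integral_def by blast
qed

section \<open>Elementary facts on real functions\<close>

text \<open>The case distinction is needed because \<open>0 powr 0 = 0\<close>.\<close>

lemma abs_powr_times_self_DERIV:
  fixes c p :: real
  assumes "c \<ge> 0"
  shows "((\<lambda>p. \<bar>p\<bar> powr c * p) has_real_derivative (c + 1) * (if c = 0 then 1 else \<bar>p\<bar> powr c)) (at p)"
proof -
  consider "p > 0" | "p < 0" | "p = 0" by linarith
  then show ?thesis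
  proof cases
    case 1
    have "((\<lambda>p. p powr (c+1)) has_real_derivative (c + 1) * p powr c) (at p)"
      using 1 by (auto intro!: derivative_eq_intros)
    then have "((\<lambda>p. \<bar>p\<bar> powr c * p) has_real_derivative (c + 1) * p powr c) (at p)"
      by (rule has_field_derivative_transform_within_open[of _ _ _ "{0<..}"]) (use 1 in \<open>auto simp: powr_add\<close>)
    then show ?thesis using 1 by (auto split: if_splits)
  next
    case 2
    have "((\<lambda>p. - ((- p) powr (c+1))) has_real_derivative (c + 1) * (- p) powr c) (at p)"
      using 2 by (auto intro!: derivative_eq_intros)
    then have "((\<lambda>p. \<bar>p\<bar> powr c * p) has_real_derivative (c + 1) * (- p) powr c) (at p)"
      by (rule has_field_derivative_transform_within_open[of _ _ _ "{..<0}"]) (use 2 in \<open>auto simp: powr_add\<close>)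
    then show ?thesis using 2 by (auto split: if_splits)
  next
    case 3
    have "((\<lambda>h. (\<bar>0 + h\<bar> powr c * (0 + h) - \<bar>0\<bar> powr c * 0) / h) \<longlongrightarrow> (c + 1) * (if c = 0 then 1 else \<bar>0::real\<bar> powr c)) (at 0)"
    proof (cases "c = 0")
      case True
      have "eventually (\<lambda>h. (1::real) = (\<bar>0 + h\<bar> powr c * (0 + h) - \<bar>0\<bar> powr c * 0) / h) (at 0)"
        by (auto simp: eventually_at_filter True)
      then show ?thesis using True by (simp add: tendsto_cong[symmetric] tendsto_eventually)
    next
      case False
      have "isCont (\<lambda>h::real. \<bar>h\<bar> powr c) 0"
        using False assms
        by (intro continuous_at_imp_continuous_on continuous_on_interior[of UNIV] continuous_on_powr' continuous_intros) auto
      then have "((\<lambda>h::real. \<bar>h\<bar> powr c) \<longlongrightarrow> 0) (at 0)" using False by (simp add: isCont_def)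
      moreover have "eventually (\<lambda>h. \<bar>h\<bar> powr c = (\<bar>0 + h\<bar> powr c * (0 + h) - \<bar>0\<bar> powr c * 0) / h) (at 0)"
        by (auto simp: eventually_at_filter)
      ultimately have "((\<lambda>h. (\<bar>0 + h\<bar> powr c * (0 + h) - \<bar>0\<bar> powr c * 0) / h) \<longlongrightarrow> 0) (at 0)"
        using tendsto_cong by force
      then show ?thesis using False by simp
    qed
    then show ?thesis unfolding 3 by (simp add: DERIV_def)
  qed
qed

text \<open>In \<open>ereal\<close> both \<open>\<infinity> - \<infinity>\<close> and \<open>- \<infinity> - (- \<infinity>)\<close> equal \<open>\<infinity>\<close>, so the hypothesis excludes these cases.\<close>

lemma ereal_diff_nonpos_imp_between:
  fixes L M :: ereal
  assumes "L - M \<le> 0" "e > 0"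
  obtains m :: real where "L < ereal (m + e)" "ereal (m - e) < M"
proof (cases L)
  case (real l)
  show ?thesis
  proof (cases M)
    case (real y) with \<open>L = ereal l\<close> assms show ?thesis by (intro that[of l]) auto
  qed (use \<open>L = ereal l\<close> assms in \<open>auto intro: that[of l]\<close>)
next
  case MInf
  then show ?thesis
  proof (cases M)
    case (real y) with MInf assms show ?thesis by (intro that[of y]) auto
  qed (use MInf assms in \<open>auto intro: that[of 0]\<close>)
qed (use assms in \<open>cases M; auto\<close>)

text \<open>The absorption argument: \<open>I \<le> C I powr (1 - 1/q)\<close> implies \<open>I \<le> C\<^sup>q\<close>. Here \<open>J\<close> is only known to be below
  numbers \<open>I\<close> that satisfy the first inequality up to \<open>\<epsilon>\<close>, without a bound on \<open>I\<close>. For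
  \<open>q = 1\<close> the power is read as \<open>1\<close> also if \<open>I = 0\<close>.\<close>

lemma le_powr_of_sublinear:
  fixes J C q :: real
  assumes q: "q \<ge> 1" and C: "C \<ge> 0"
    and sub: "\<And>\<epsilon>. \<epsilon> > 0 \<Longrightarrow> \<exists>I \<ge> J. I \<le> \<epsilon> + C * (if q = 1 then 1 else I powr (1 - 1 / q))"
  shows "J \<le> C powr q"
proof (rule ccontr)
  assume "\<not> J \<le> C powr q"
  then have J: "J > C powr q" by simp
  then have "J > 0" using powr_ge_zero[of C q] by linarith
  have C_eq: "C = (C powr q) powr (1 / q)" using q C by (simp add: powr_powr)
  also have "\<dots> < J powr (1 / q)" using J q by (intro powr_less_mono2) auto
  finally have CJ: "C < J powr (1 / q)" .
  \<comment> \<open>Half the gap at \<open>J\<close> of the map \<open>t \<mapsto> t - C t powr (1 - 1 / q)\<close>, which is increasing from there on.\<close>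
  define \<epsilon> where "\<epsilon> = J powr (1 - 1 / q) * (J powr (1 / q) - C) / 2"
  have "\<epsilon> > 0" using CJ \<open>J > 0\<close> by (simp add: \<epsilon>_def)
  then obtain I where I: "I \<ge> J" "I \<le> \<epsilon> + C * (if q = 1 then 1 else I powr (1 - 1 / q))"
    using sub by blast
  have "I > 0" using I \<open>J > 0\<close> by simp
  then have 1: "(if q = 1 then 1 else I powr (1 - 1 / q)) = I powr (1 - 1 / q)" by simp
  have "I = I powr (1 - 1 / q) * I powr (1 / q)" using \<open>I > 0\<close> by (simp flip: powr_add)
  then have "I powr (1 - 1 / q) * (I powr (1 / q) - C) \<le> \<epsilon>" using I 1 by (simp add: algebra_simps)
  moreover have "J powr (1 - 1 / q) * (J powr (1 / q) - C) \<le> I powr (1 - 1 / q) * (I powr (1 / q) - C)"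
    using q I \<open>J > 0\<close> CJ by (intro mult_mono powr_mono2 diff_right_mono) auto
  ultimately show False using \<open>\<epsilon> > 0\<close> by (simp add: \<epsilon>_def)
qed

lemma le_abs_inv:
  assumes cont: "continuous_on {0<..} G" and mono: "strict_mono_on {0<..} (\<lambda>l. \<bar>G l\<bar>)"
    and "x > 0" "\<bar>G x\<bar> \<le> s"
  shows "ereal \<bar>x\<bar> \<le> abs_inv G s"
proof (cases "(SUP l\<in>{0<..}. ereal \<bar>G l\<bar>) \<le> ereal s")
  case False
  then obtain l where l: "l > 0" "s < \<bar>G l\<bar>"
    by (auto simp: not_le less_SUP_iff)
  have "x < l"
  proof (rule ccontr)
    assume "\<not> x < l"
    then have "\<bar>G l\<bar> \<le> \<bar>G x\<bar>"
      using strict_mono_onD[OF mono, of l x] l \<open>x > 0\<close> by (cases "l = x") auto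
    then show False using l \<open>\<bar>G x\<bar> \<le> s\<close> by simp
  qed
  have "continuous_on {x..l} (\<lambda>l. \<bar>G l\<bar>)"
    using \<open>x > 0\<close> by (intro continuous_intros continuous_on_subset[OF cont]) auto
  then obtain z where z: "x \<le> z" "z \<le> l" "\<bar>G z\<bar> = s"
    using IVT'[of "\<lambda>l. \<bar>G l\<bar>" x s l] \<open>\<bar>G x\<bar> \<le> s\<close> l \<open>x < l\<close> by auto
  have "inj_on (\<lambda>l. \<bar>G l\<bar>) {0<..}" using mono by (rule strict_mono_on_imp_inj_on)
  then have "the_inv_into {0<..} (\<lambda>l. \<bar>G l\<bar>) s = z"
    using z \<open>x > 0\<close> by (intro the_inv_into_f_eq) auto
  then show ?thesis using False z \<open>x > 0\<close> by (simp add: abs_inv_def)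
qed (simp add: abs_inv_def)

section \<open>The energy inequality\<close>

text \<open>The equation with the hypotheses on the transforms replaced by the relations between \<open>\<tau>\<close>, \<open>h\<close>, \<open>H\<close>, \<open>G\<close>
  that they are designed to satisfy.\<close>

locale transformed_ode =
  fixes q :: real and a b :: ereal and g \<tau> h H G f :: "real \<Rightarrow> real"
  assumes q: "1 \<le> q" and ab: "a < b"
    and g: "Lq_on q (einterval a b) g"
    and \<tau>_pos: "\<And>l. l > 0 \<Longrightarrow> \<tau> l > 0" and \<tau>_cont: "continuous_on {0<..} \<tau>"
    and H_deriv: "\<And>l. l > 0 \<Longrightarrow> (H has_real_derivative h l) (at l)"
    and h_pos: "\<And>l. l > 0 \<Longrightarrow> h l > 0" and h_cont: "continuous_on {0<..} h"
    and \<tau>_H: "\<And>l. l > 0 \<Longrightarrow> \<tau> l * \<bar>H l\<bar> = h l powr (1 - 1 / q)"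
    and G_deriv: "\<And>l. l > 0 \<Longrightarrow> (G has_real_derivative h l powr (1 / (2 * q))) (at l)"
    and f_W: "W21_loc_on (einterval a b) f"
    and f_pos: "\<And>x. x \<in> einterval a b \<Longrightarrow> f x > 0"
    and ode: "AE x in lebesgue. x \<in> einterval a b \<longrightarrow>
           (deriv f has_real_derivative g x * \<tau> (f x)) (at x)"
    and boundary:
      "Liminf (at_left b) (\<lambda>R. ereal ((\<lambda>x. \<bar>deriv f x\<bar> powr (2 * q - 2) * deriv f x
           * H (f x)) (real_of_ereal R)))
       - Limsup (at_right a) (\<lambda>r. ereal ((\<lambda>x. \<bar>deriv f x\<bar> powr (2 * q - 2) * deriv f x
           * H (f x)) (real_of_ereal r))) \<le> 0"
begin

text \<open>The interval on which the equation holds.\<close>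

abbreviation "S \<equiv> einterval a b"

text \<open>The energy density.\<close>

definition "E x = \<bar>deriv f x\<bar> powr (2 * q) * h (f x)"

text \<open>The boundary term: its increments control the energy.\<close>

definition "\<Phi> x = \<bar>deriv f x\<bar> powr (2 * q - 2) * deriv f x * H (f x)"

text \<open>The \<open>q\<close>-th power of the \<open>L\<^sup>q\<close> norm of \<open>g\<close>.\<close>

definition "Q = (LINT x:S|lebesgue. \<bar>g x\<bar> powr q)"

lemma Q_nonneg: "Q \<ge> 0"
  unfolding Q_def set_lebesgue_integral_def by (intro Bochner_Integration.integral_nonneg) auto

lemma Icc_subset: "r \<in> S \<Longrightarrow> R \<in> S \<Longrightarrow> {r..R} \<subseteq> S"
  by (auto simp: einterval_iff) (meson ereal_less_eq(3) less_le_trans le_less_trans)+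

lemma f_deriv: "x \<in> S \<Longrightarrow> (f has_real_derivative deriv f x) (at x)"
  using f_W by (simp add: W21_loc_on_def DERIV_deriv_iff_field_differentiable)

lemma f_cont: "continuous_on S f"
  using f_deriv by (meson DERIV_isCont continuous_at_imp_continuous_on)

lemma f'_cont: "continuous_on S (deriv f)"
  using f_W by (auto simp: W21_loc_on_def intro: locally_absolutely_continuous_on_imp_continuous_on)

lemma f'_ac: "{r..R} \<subseteq> S \<Longrightarrow> absolutely_continuous_on {r..R} (deriv f)"
  using f_W by (auto simp: W21_loc_on_def locally_absolutely_continuous_on_def)

lemma comp_f_cont: "continuous_on {0<..} w \<Longrightarrow> continuous_on S (\<lambda>x. w (f x))"
  by (rule continuous_on_compose2[OF _ f_cont]) (auto intro: f_pos)

lemma H_cont: "continuous_on {0<..} H"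
  using H_deriv by (meson DERIV_isCont continuous_at_imp_continuous_on greaterThan_iff)

lemma E_nonneg: "x \<in> S \<Longrightarrow> E x \<ge> 0"
  using h_pos[OF f_pos] by (simp add: E_def less_imp_le)

lemma E_cont: "continuous_on S E"
  unfolding E_def using q
  by (intro continuous_intros comp_f_cont[OF h_cont] continuous_on_powr' f'_cont) auto

lemma E_integrable_Icc: "{r..R} \<subseteq> S \<Longrightarrow> set_integrable lebesgue {r..R} E"
  by (intro absolutely_integrable_continuous_real continuous_on_subset[OF E_cont])

lemma g_integrable:
  assumes "A \<in> lmeasurable" "A \<subseteq> S"
  shows "set_integrable lebesgue A g"
proof (rule set_integrable_bound)
  have "set_integrable lebesgue A (\<lambda>x. \<bar>g x\<bar> powr q)"
    using g assms unfolding Lq_on_def by (auto intro: set_integrable_subset)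
  moreover have "set_integrable lebesgue A (\<lambda>x. 1 :: real)"
    using assms(1) by (auto simp: set_integrable_def fmeasurable_def intro!: integrable_real_indicator)
  ultimately show "set_integrable lebesgue A (\<lambda>x. 1 + \<bar>g x\<bar> powr q)" by (intro set_integral_add)
  show "set_borel_measurable lebesgue A g"
    using g assms unfolding Lq_on_def by (auto intro: set_borel_measurable_subset)
  have "\<bar>t\<bar> \<le> 1 + \<bar>t\<bar> powr q" for t :: real
  proof (cases "\<bar>t\<bar> \<le> 1")
    case False
    then have "\<bar>t\<bar> powr 1 \<le> \<bar>t\<bar> powr q" using q by (intro powr_mono) auto
    then show ?thesis using False by simp
  qed (use powr_ge_zero[of "\<bar>t\<bar>" q] in linarith)
  then show "AE x in lebesgue. x \<in> A \<longrightarrow> norm (g x) \<le> norm (1 + \<bar>g x\<bar> powr q)"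
    by (auto simp: add_nonneg_nonneg)
qed

lemma g_times_cont_integrable:
  assumes "{r..R} \<subseteq> S" "continuous_on S w"
  shows "set_integrable lebesgue {r..R} (\<lambda>x. w x * g x)"
proof -
  have cont: "continuous_on {r..R} w" using assms continuous_on_subset by blast
  have "set_integrable lebesgue {r..R} g" using g_integrable[of "{r..R}"] assms by auto
  moreover have "bounded (w ` {r..R})"
    using cont compact_continuous_image compact_imp_bounded by blast
  moreover have "w \<in> borel_measurable (lebesgue_on {r..R})"
    by (rule continuous_imp_measurable_on_sets_lebesgue[OF cont]) (simp add: fmeasurableD)
  ultimately show ?thesis
    using absolutely_integrable_bounded_measurable_product_real[of w "{r..R}" g] by auto
qed

text \<open>Up to the factor \<open>2 q - 1\<close> the derivative of \<open>p \<mapsto> \<bar>p\<bar>\<^sup>2\<^sup>q\<^sup>-\<^sup>2 p\<close>, that is \<open>\<bar>p\<bar>\<^sup>2\<^sup>q\<^sup>-\<^sup>2\<close> with the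
  convention \<open>0\<^sup>0 = 1\<close>, which differs from that of \<open>powr\<close>.\<close>

definition "\<psi> p = (if q = 1 then 1 else \<bar>p\<bar> powr (2 * q - 2))" for p :: real

lemma \<psi>_cont: "continuous_on UNIV \<psi>"
  using q unfolding \<psi>_def by (cases "q = 1") (auto intro!: continuous_intros continuous_on_powr')

lemma spow_deriv: "((\<lambda>p. \<bar>p\<bar> powr (2 * q - 2) * p) has_real_derivative (2 * q - 1) * \<psi> p) (at p)"
  using abs_powr_times_self_DERIV[of "2 * q - 2" p] q by (simp add: \<psi>_def)

lemma \<Phi>_deriv:
  assumes "x \<in> S" "(deriv f has_real_derivative d) (at x)"
  shows "(\<Phi> has_real_derivative (2 * q - 1) * \<psi> (deriv f x) * d * H (f x) + E x) (at x)"
proof -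
  have 1: "((\<lambda>x. \<bar>deriv f x\<bar> powr (2 * q - 2) * deriv f x) has_real_derivative (2 * q - 1) * \<psi> (deriv f x) * d) (at x)"
    using DERIV_chain2[OF spow_deriv assms(2)] by simp
  have 2: "((\<lambda>x. H (f x)) has_real_derivative h (f x) * deriv f x) (at x)"
    by (rule DERIV_chain2[OF H_deriv[OF f_pos] f_deriv]) fact+
  have "\<bar>p\<bar> powr (2 * q) = \<bar>p\<bar> powr (2 * q - 2) * p * p" for p :: real
  proof (cases "p = 0")
    case False
    have "\<bar>p\<bar> powr (2 * q) = \<bar>p\<bar> powr (2 * q - 2 + 2)" by simp
    also have "\<dots> = \<bar>p\<bar> powr (2 * q - 2) * \<bar>p\<bar> powr 2" by (rule powr_add)
    also have "\<bar>p\<bar> powr 2 = p * p" using False by (simp add: powr_numeral power2_eq_square)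
    finally show ?thesis by simp
  qed simp
  then have "E x = h (f x) * deriv f x * (\<bar>deriv f x\<bar> powr (2 * q - 2) * deriv f x)"
    by (simp add: E_def algebra_simps)
  then show ?thesis unfolding \<Phi>_def using DERIV_mult[OF 1 2] by simp
qed

lemma \<Phi>_ac:
  assumes rR: "{r..R} \<subseteq> S"
  shows "absolutely_continuous_on {r..R} \<Phi>"
proof -
  define P where "P p = \<bar>p\<bar> powr (2 * q - 2) * p" for p :: real
  have f'c: "continuous_on {r..R} (deriv f)" using f'_cont rR continuous_on_subset by blast
  then have "bounded (deriv f ` {r..R})" using compact_continuous_image compact_imp_bounded by blast
  then obtain M where M: "M > 0" "\<And>x. x \<in> {r..R} \<Longrightarrow> \<bar>deriv f x\<bar> \<le> M" unfolding bounded_pos by auto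
  have "continuous_on {-M..M} (\<lambda>p. (2 * q - 1) * \<psi> p)"
    by (intro continuous_intros continuous_on_subset[OF \<psi>_cont]) auto
  then obtain L1 where L1: "L1 \<ge> 0" "\<And>u v. u \<in> {-M..M} \<Longrightarrow> v \<in> {-M..M} \<Longrightarrow> \<bar>P v - P u\<bar> \<le> L1 * \<bar>v - u\<bar>"
    using C1_imp_lipschitz[of "-M" M P "\<lambda>p. (2 * q - 1) * \<psi> p"] spow_deriv unfolding P_def by blast
  have "continuous_on {r..R} (\<lambda>x. h (f x) * deriv f x)"
    using comp_f_cont[OF h_cont] rR f'c by (intro continuous_intros) (auto intro: continuous_on_subset)
  moreover have "((\<lambda>x. H (f x)) has_real_derivative h (f x) * deriv f x) (at x)" if "x \<in> {r..R}" for x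
    using that rR by (intro DERIV_chain2[OF H_deriv[OF f_pos] f_deriv]) auto
  ultimately obtain L2 where L2: "L2 \<ge> 0"
    "\<And>u v. u \<in> {r..R} \<Longrightarrow> v \<in> {r..R} \<Longrightarrow> \<bar>H (f v) - H (f u)\<bar> \<le> L2 * \<bar>v - u\<bar>"
    using C1_imp_lipschitz[of r R "\<lambda>x. H (f x)" "\<lambda>x. h (f x) * deriv f x"] by blast
  have "continuous_on {r..R} (\<lambda>x. H (f x))" using comp_f_cont[OF H_cont] rR continuous_on_subset by blast
  then have "bounded ((\<lambda>x. H (f x)) ` {r..R})" using compact_continuous_image compact_imp_bounded by blast
  then obtain B where B: "B > 0" "\<And>x. x \<in> {r..R} \<Longrightarrow> \<bar>H (f x)\<bar> \<le> B" unfolding bounded_pos by auto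
  have "continuous_on {r..R} (\<lambda>x. P (deriv f x))"
    unfolding P_def using spow_deriv
    by (intro continuous_on_compose2[OF _ f'c, of UNIV]) (auto intro!: continuous_at_imp_continuous_on DERIV_isCont)
  then have "bounded ((\<lambda>x. P (deriv f x)) ` {r..R})" using compact_continuous_image compact_imp_bounded by blast
  then obtain D where D: "D > 0" "\<And>x. x \<in> {r..R} \<Longrightarrow> \<bar>P (deriv f x)\<bar> \<le> D" unfolding bounded_pos by auto
  show ?thesis
  proof (rule absolutely_continuous_on_lipschitz_comb[OF f'_ac[OF rR], of "L1 * B + D * L2"])
    show "0 \<le> L1 * B + D * L2" using L1 L2 B D by simp
    fix u v assume uv: "u \<in> {r..R}" "v \<in> {r..R}"
    have "\<Phi> v - \<Phi> u = (P (deriv f v) - P (deriv f u)) * H (f v) + P (deriv f u) * (H (f v) - H (f u))"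
      by (simp add: \<Phi>_def P_def algebra_simps)
    also have "\<bar>\<dots>\<bar> \<le> \<bar>P (deriv f v) - P (deriv f u)\<bar> * \<bar>H (f v)\<bar> + \<bar>P (deriv f u)\<bar> * \<bar>H (f v) - H (f u)\<bar>"
      by (metis abs_triangle_ineq abs_mult)
    also have "\<dots> \<le> (L1 * \<bar>deriv f v - deriv f u\<bar>) * B + D * (L2 * \<bar>v - u\<bar>)"
    proof (intro add_mono mult_mono)
      show "\<bar>P (deriv f v) - P (deriv f u)\<bar> \<le> L1 * \<bar>deriv f v - deriv f u\<bar>"
        using M(2)[OF uv(1)] M(2)[OF uv(2)] by (intro L1(2)) auto
    qed (use uv B D L1 L2 in auto)
    also have "\<dots> \<le> (L1 * B + D * L2) * (\<bar>deriv f v - deriv f u\<bar> + \<bar>v - u\<bar>)"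
    proof -
      have "0 \<le> L1 * B * \<bar>v - u\<bar>" "0 \<le> D * L2 * \<bar>deriv f v - deriv f u\<bar>" using L1 L2 B D by auto
      then show ?thesis by (simp add: algebra_simps)
    qed
    finally show "\<bar>\<Phi> v - \<Phi> u\<bar> \<le> (L1 * B + D * L2) * (\<bar>deriv f v - deriv f u\<bar> + \<bar>v - u\<bar>)" .
  qed
qed

lemma ode_exceptional_set:
  obtains N where "negligible N"
    "\<And>x. x \<in> S \<Longrightarrow> x \<notin> N \<Longrightarrow> (deriv f has_real_derivative g x * \<tau> (f x)) (at x)"
proof -
  obtain N where "N \<in> null_sets lebesgue"
    "{x. \<not> (x \<in> S \<longrightarrow> (deriv f has_real_derivative g x * \<tau> (f x)) (at x))} \<subseteq> N"
    using ode by (auto simp: eventually_ae_filter)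
  then show ?thesis by (intro that[of N]) (auto simp: negligible_iff_null_sets)
qed

text \<open>The part of \<open>\<Phi>'\<close> that contains \<open>f''\<close>, rewritten by means of the equation.\<close>

definition "W x = (2 * q - 1) * \<psi> (deriv f x) * (g x * \<tau> (f x)) * H (f x)"

lemma W_integrable: "{r..R} \<subseteq> S \<Longrightarrow> set_integrable lebesgue {r..R} W"
proof -
  assume rR: "{r..R} \<subseteq> S"
  have "continuous_on S (\<lambda>x. (2 * q - 1) * \<psi> (deriv f x) * \<tau> (f x) * H (f x))"
    by (intro continuous_intros comp_f_cont \<tau>_cont H_cont continuous_on_compose2[OF \<psi>_cont f'_cont]) auto
  from g_times_cont_integrable[OF rR this] show ?thesis
    unfolding W_def by (simp add: mult_ac)
qed

lemma energy_identity:
  assumes rR: "{r..R} \<subseteq> S" "r \<le> R"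
  shows "(LINT x:{r..R}|lebesgue. E x) = \<Phi> R - \<Phi> r - (LINT x:{r..R}|lebesgue. W x)"
proof -
  obtain N where N: "negligible N"
    "\<And>x. x \<in> S \<Longrightarrow> x \<notin> N \<Longrightarrow> (deriv f has_real_derivative g x * \<tau> (f x)) (at x)"
    using ode_exceptional_set by blast
  have "((\<lambda>x. W x + E x) has_integral \<Phi> R - \<Phi> r) {r..R}"
  proof (rule absolutely_continuous_on_has_integral[OF rR(2) \<Phi>_ac[OF rR(1)] N(1)])
    fix x assume "x \<in> {r..R} - N"
    then have "(\<Phi> has_real_derivative W x + E x) (at x)"
      unfolding W_def using rR by (intro \<Phi>_deriv N(2)) auto
    then show "(\<Phi> has_vector_derivative W x + E x) (at x within {r..R})"
      by (simp add: has_real_derivative_iff_has_vector_derivative has_vector_derivative_at_within)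
  qed
  then have "\<Phi> R - \<Phi> r = integral {r..R} (\<lambda>x. W x + E x)" by (simp add: integral_unique)
  also have "\<dots> = (LINT x:{r..R}|lebesgue. W x + E x)"
    using W_integrable[OF rR(1)] E_integrable_Icc[OF rR(1)]
    by (intro set_lebesgue_integral_eq_integral(2)[symmetric] set_integral_add) auto
  also have "\<dots> = (LINT x:{r..R}|lebesgue. W x) + (LINT x:{r..R}|lebesgue. E x)"
    using W_integrable[OF rR(1)] E_integrable_Icc[OF rR(1)] by (rule set_integral_add)
  finally show ?thesis by simp
qed

text \<open>This is where \<open>\<tau> \<bar>H\<bar> = h powr (1 - 1/q)\<close> enters: the powers of \<open>\<bar>f'\<bar>\<close> and \<open>h(f)\<close> combine to a power
  of the energy density.\<close>

lemma \<psi>_E_pointwise: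
  assumes "x \<in> S"
  shows "\<bar>\<psi> (deriv f x) * (g x * \<tau> (f x)) * H (f x)\<bar>
    = \<bar>g x * (if q = 1 then 1 else E x powr (1 - 1 / q))\<bar>"
proof -
  have fp: "f x > 0" using f_pos[OF assms] .
  have hp: "h (f x) > 0" using h_pos[OF fp] .
  have tH: "\<bar>\<tau> (f x) * H (f x)\<bar> = h (f x) powr (1 - 1 / q)"
    using \<tau>_H[OF fp] \<tau>_pos[OF fp] by (simp add: abs_mult)
  have "\<bar>\<psi> (deriv f x) * (g x * \<tau> (f x)) * H (f x)\<bar> = \<bar>g x\<bar> * (\<bar>\<psi> (deriv f x)\<bar> * \<bar>\<tau> (f x) * H (f x)\<bar>)"
    by (simp add: abs_mult mult_ac)
  also have "\<bar>\<psi> (deriv f x)\<bar> * \<bar>\<tau> (f x) * H (f x)\<bar> = (if q = 1 then 1 else E x powr (1 - 1 / q))"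
  proof (cases "q = 1")
    case True
    have "\<psi> (deriv f x) = 1" unfolding \<psi>_def using True by simp
    then show ?thesis using hp True by (simp add: tH)
  next
    case False
    have "E x powr (1 - 1 / q) = \<bar>deriv f x\<bar> powr (2 * q * (1 - 1 / q)) * h (f x) powr (1 - 1 / q)"
      using hp by (simp add: E_def powr_mult powr_powr)
    also have "2 * q * (1 - 1 / q) = 2 * q - 2" using q by (simp add: field_simps)
    finally show ?thesis using False by (simp add: tH \<psi>_def)
  qed
  also have "\<bar>g x\<bar> * \<dots> = \<bar>g x * \<dots>\<bar>" by (simp add: abs_mult)
  finally show ?thesis .
qed

lemma Q_mono:
  assumes "A \<in> sets lebesgue" "A \<subseteq> S"
  shows "set_integrable lebesgue A (\<lambda>x. \<bar>g x\<bar> powr q)" "(LINT x:A|lebesgue. \<bar>g x\<bar> powr q) \<le> Q"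
proof -
  have S: "set_integrable lebesgue S (\<lambda>x. \<bar>g x\<bar> powr q)" using g by (simp add: Lq_on_def)
  show A: "set_integrable lebesgue A (\<lambda>x. \<bar>g x\<bar> powr q)" by (rule set_integrable_subset[OF S]) (use assms in auto)
  show "(LINT x:A|lebesgue. \<bar>g x\<bar> powr q) \<le> Q"
    unfolding Q_def by (rule set_integral_mono_set[OF S assms]) simp
qed

lemma W_integral_bound:
  assumes rR: "{r..R} \<subseteq> S"
  shows "(LINT x:{r..R}|lebesgue. \<bar>W x\<bar>) \<le> (2 * q - 1) * Q powr (1 / q) *
    (if q = 1 then 1 else (LINT x:{r..R}|lebesgue. E x) powr (1 - 1 / q))"
proof -
  define v where "v x = (if q = 1 then 1 else E x powr (1 - 1 / q))" for x
  have rRm: "{r..R} \<in> sets lebesgue" by (simp add: fmeasurableD)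
  have Wv: "\<bar>W x\<bar> = (2 * q - 1) * \<bar>g x * v x\<bar>" if "x \<in> {r..R}" for x
    using \<psi>_E_pointwise[of x] that rR q unfolding W_def v_def by (auto simp: abs_mult mult_ac)
  have "(LINT x:{r..R}|lebesgue. \<bar>W x\<bar>) = (LINT x:{r..R}|lebesgue. (2 * q - 1) * \<bar>g x * v x\<bar>)"
    by (rule set_lebesgue_integral_cong) (use rRm Wv in auto)
  also have "\<dots> = (2 * q - 1) * (LINT x:{r..R}|lebesgue. \<bar>g x * v x\<bar>)" by simp
  also have "\<dots> \<le> (2 * q - 1) * (Q powr (1 / q) * (if q = 1 then 1 else (LINT x:{r..R}|lebesgue. E x) powr (1 - 1 / q)))"
  proof (rule mult_left_mono)
    show "(LINT x:{r..R}|lebesgue. \<bar>g x * v x\<bar>)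
      \<le> Q powr (1 / q) * (if q = 1 then 1 else (LINT x:{r..R}|lebesgue. E x) powr (1 - 1 / q))"
    proof (cases "q = 1")
      case True
      then show ?thesis using Q_mono(2)[OF rRm rR] Q_nonneg by (simp add: v_def)
    next
      case False
      \<comment> \<open>The exponent conjugate to \<open>q\<close>.\<close>
      define p' where "p' = q / (q - 1)"
      have q1: "q > 1" using False q by simp
      have p': "p' > 1" "1 / q + 1 / p' = 1" "1 / p' = 1 - 1 / q" using q1 by (auto simp: p'_def field_simps)
      have vE: "\<bar>v x\<bar> powr p' = E x" if "x \<in> {r..R}" for x
      proof -
        have "(1 - 1 / q) * p' = 1" using q1 by (simp add: p'_def field_simps)
        moreover have "E x \<ge> 0" using E_nonneg that rR by auto
        ultimately show ?thesis using False by (simp add: v_def powr_powr)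
      qed
      have meas: "set_borel_measurable lebesgue {r..R} g"
        using g rRm rR unfolding Lq_on_def by (auto intro: set_borel_measurable_subset)
      have "continuous_on {r..R} v"
      proof -
        have "continuous_on {r..R} (\<lambda>x. E x powr (1 - 1 / q))"
        proof (rule continuous_on_powr')
          show "\<forall>x\<in>{r..R}. 0 \<le> E x \<and> (E x = 0 \<longrightarrow> 0 < 1 - 1 / q)"
            using q1 E_nonneg rR by auto
        qed (auto intro: continuous_on_subset[OF E_cont rR])
        then show ?thesis using False by (simp add: v_def)
      qed
      then have vm: "set_borel_measurable lebesgue {r..R} v" by (rule set_borel_measurable_continuous) simp
      have vi: "set_integrable lebesgue {r..R} (\<lambda>x. \<bar>v x\<bar> powr p')"
        using E_integrable_Icc[OF rR] vE by (subst set_integrable_cong[OF refl refl]) auto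
      have "(LINT x:{r..R}|lebesgue. \<bar>g x * v x\<bar>)
        \<le> (LINT x:{r..R}|lebesgue. \<bar>g x\<bar> powr q) powr (1 / q) * (LINT x:{r..R}|lebesgue. \<bar>v x\<bar> powr p') powr (1 / p')"
        using Hoelder_inequality_set_integral(2)[OF q1 p'(1,2) meas Q_mono(1)[OF rRm rR] vm vi] .
      also have "(LINT x:{r..R}|lebesgue. \<bar>v x\<bar> powr p') = (LINT x:{r..R}|lebesgue. E x)"
        by (rule set_lebesgue_integral_cong) (use rRm vE in auto)
      also have "(LINT x:{r..R}|lebesgue. \<bar>g x\<bar> powr q) powr (1 / q) \<le> Q powr (1 / q)"
        using Q_mono(2)[OF rRm rR] q by (intro powr_mono2) (auto simp: set_lebesgue_integral_def intro!: Bochner_Integration.integral_nonneg)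
      finally show ?thesis using False by (simp add: p'(3) mult_right_mono)
    qed
  qed (use q in simp)
  finally show ?thesis by (simp add: mult_ac)
qed

lemma energy_estimate:
  assumes rR: "{r..R} \<subseteq> S" "r \<le> R"
  shows "(LINT x:{r..R}|lebesgue. E x) \<le> \<Phi> R - \<Phi> r + (2 * q - 1) * Q powr (1 / q) *
    (if q = 1 then 1 else (LINT x:{r..R}|lebesgue. E x) powr (1 - 1 / q))"
proof -
  have "- (LINT x:{r..R}|lebesgue. W x) = (LINT x:{r..R}|lebesgue. - W x)"
    using W_integrable[OF rR(1)] by (simp add: set_integral_uminus)
  also have "\<dots> \<le> (LINT x:{r..R}|lebesgue. \<bar>W x\<bar>)"
    using W_integrable[OF rR(1)] by (intro set_integral_mono set_integrable_abs) (auto simp: set_integrable_def)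
  finally show ?thesis using energy_identity[OF rR] W_integral_bound[OF rR(1)] by linarith
qed

text \<open>The only use of the boundary condition.\<close>

lemma near_boundary:
  assumes "\<epsilon> > 0" "r0 \<in> S" "R0 \<in> S"
  obtains r R where "r \<in> S" "R \<in> S" "r \<le> r0" "R0 \<le> R" "\<Phi> R - \<Phi> r \<le> \<epsilon>"
proof -
  define L where "L = Liminf (at_left b) (\<lambda>R. ereal (\<Phi> (real_of_ereal R)))"
  define M where "M = Limsup (at_right a) (\<lambda>r. ereal (\<Phi> (real_of_ereal r)))"
  have "L - M \<le> 0" using boundary by (simp add: L_def M_def \<Phi>_def)
  then obtain m :: real where m: "L < ereal (m + \<epsilon> / 2)" "ereal (m - \<epsilon> / 2) < M"
    using ereal_diff_nonpos_imp_between[of L M "\<epsilon> / 2"] \<open>\<epsilon> > 0\<close> by auto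
  \<comment> \<open>A value strictly above a lower limit is not an eventual lower bound.\<close>
  have "\<exists>R\<in>S. R0 \<le> R \<and> \<Phi> R < m + \<epsilon> / 2"
  proof (rule ccontr)
    assume *: "\<not> ?thesis"
    have "ereal (m + \<epsilon> / 2) \<le> ereal (\<Phi> (real_of_ereal y))" if y: "ereal R0 < y" "y < b" for y
    proof -
      obtain R where R: "y = ereal R" using y by (cases y) auto
      have "R \<in> S" "R0 \<le> R" using y \<open>R0 \<in> S\<close> by (auto simp: R einterval_iff intro: less_trans)
      then show ?thesis using * R by auto
    qed
    moreover have "ereal R0 < b" using \<open>R0 \<in> S\<close> by (simp add: einterval_iff)
    ultimately have "eventually (\<lambda>y. ereal (m + \<epsilon> / 2) \<le> ereal (\<Phi> (real_of_ereal y))) (at_left b)"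
      unfolding eventually_at_left[OF \<open>ereal R0 < b\<close>] by blast
    then have "ereal (m + \<epsilon> / 2) \<le> L" unfolding L_def by (rule Liminf_bounded)
    then show False using m by simp
  qed
  then obtain R where R: "R \<in> S" "R0 \<le> R" "\<Phi> R < m + \<epsilon> / 2" by blast
  have "\<exists>r\<in>S. r \<le> r0 \<and> m - \<epsilon> / 2 < \<Phi> r"
  proof (rule ccontr)
    assume *: "\<not> ?thesis"
    have "ereal (\<Phi> (real_of_ereal y)) \<le> ereal (m - \<epsilon> / 2)" if y: "a < y" "y < ereal r0" for y
    proof -
      obtain r where r: "y = ereal r" using y by (cases y) auto
      have "r \<in> S" "r \<le> r0" using y \<open>r0 \<in> S\<close> by (auto simp: r einterval_iff intro: less_trans[of "ereal r" "ereal r0" b])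
      then show ?thesis using * r by auto
    qed
    moreover have "a < ereal r0" using \<open>r0 \<in> S\<close> by (simp add: einterval_iff)
    ultimately have "eventually (\<lambda>y. ereal (\<Phi> (real_of_ereal y)) \<le> ereal (m - \<epsilon> / 2)) (at_right a)"
      unfolding eventually_at_right[OF \<open>a < ereal r0\<close>] by blast
    then have "M \<le> ereal (m - \<epsilon> / 2)" unfolding M_def by (rule Limsup_bounded)
    then show False using m by simp
  qed
  then obtain r where r: "r \<in> S" "r \<le> r0" "m - \<epsilon> / 2 < \<Phi> r" by blast
  show ?thesis using that[of r R] r R by simp
qed

lemma energy_Icc_mono:
  assumes "{r'..R'} \<subseteq> S" "r' \<le> r" "R \<le> R'"
  shows "(LINT x:{r..R}|lebesgue. E x) \<le> (LINT x:{r'..R'}|lebesgue. E x)"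
  by (rule set_integral_mono_set[OF E_integrable_Icc[OF assms(1)]])
    (use assms E_nonneg in \<open>auto simp: fmeasurableD\<close>)

text \<open>The energy on \<open>[r, R]\<close> is at most that on larger intervals \<open>[r', R']\<close> on which \<open>\<Phi>\<close> increases by at most
  \<open>\<epsilon>\<close>.\<close>

lemma energy_bound_Icc:
  assumes "r \<in> S" "R \<in> S" "r \<le> R"
  shows "(LINT x:{r..R}|lebesgue. E x) \<le> (2 * q - 1) powr q * Q"
proof -
  define C where "C = (2 * q - 1) * Q powr (1 / q)"
  have "(LINT x:{r..R}|lebesgue. E x) \<le> C powr q"
  proof (rule le_powr_of_sublinear[OF q])
    show "C \<ge> 0" using q by (simp add: C_def)
    fix \<epsilon> :: real assume "\<epsilon> > 0"
    then obtain r' R' where *: "r' \<in> S" "R' \<in> S" "r' \<le> r" "R \<le> R'" "\<Phi> R' - \<Phi> r' \<le> \<epsilon>"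
      using near_boundary[of \<epsilon> r R] assms by blast
    let ?I = "LINT x:{r'..R'}|lebesgue. E x"
    have "?I \<le> \<epsilon> + C * (if q = 1 then 1 else ?I powr (1 - 1 / q))"
      using energy_estimate[OF Icc_subset[OF *(1,2)]] * assms(3) unfolding C_def by linarith
    moreover have "(LINT x:{r..R}|lebesgue. E x) \<le> ?I"
      using energy_Icc_mono[OF Icc_subset[OF *(1,2)] *(3,4)] .
    ultimately show "\<exists>I\<ge>(LINT x:{r..R}|lebesgue. E x). I \<le> \<epsilon> + C * (if q = 1 then 1 else I powr (1 - 1 / q))"
      by blast
  qed
  also have "C powr q = (2 * q - 1) powr q * Q"
    using q Q_nonneg by (simp add: C_def powr_mult powr_powr)
  finally show ?thesis .
qed

lemma energy_bound:
  shows "set_integrable lebesgue S E" "(LINT x:S|lebesgue. E x) \<le> (2 * q - 1) powr q * Q"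
proof -
  obtain u l :: "nat \<Rightarrow> real" where ul: "S = (\<Union>i. {l i .. u i})" "incseq u" "decseq l"
    "\<And>i. l i < u i" "\<And>i. a < l i" "\<And>i. u i < b"
    by (rule einterval_Icc_approximation[OF ab]) blast
  define A where "A i = {l i..u i}" for i
  have A: "A i \<in> sets lebesgue" for i by (simp add: A_def fmeasurableD)
  have inc: "incseq A"
    unfolding incseq_def A_def using incseqD[OF ul(2)] decseqD[OF ul(3)] by simp
  have AS: "{l i..u i} \<subseteq> S" for i using ul(1) by blast
  have ulS: "l i \<in> S" "u i \<in> S" for i using AS[of i] ul(4)[of i] by auto
  define J where "J i = (LINT x:A i|lebesgue. E x)" for i
  have J: "J i \<le> (2 * q - 1) powr q * Q" for i
    unfolding J_def A_def using energy_bound_Icc ulS ul(4) less_imp_le by blast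
  have "incseq J"
    unfolding incseq_def J_def A_def using incseqD[OF ul(2)] decseqD[OF ul(3)] AS
    by (intro allI impI energy_Icc_mono)
  then obtain c where c: "J \<longlonglongrightarrow> c" using incseq_convergent J by blast
  show int: "set_integrable lebesgue S E"
    unfolding ul(1) A_def[symmetric]
  proof (rule pos_integrable_to_top)
    show "mono A" using inc by (simp add: mono_def incseq_def)
    show "0 \<le> E x" if "x \<in> A i" for x i using that AS[of i] E_nonneg by (auto simp: A_def)
    show "set_integrable lebesgue (A i) E" for i unfolding A_def by (rule E_integrable_Icc[OF AS])
    show "(\<lambda>i. LINT x:A i|lebesgue. E x) \<longlonglongrightarrow> c" using c by (simp add: J_def[abs_def])
  qed (rule A)
  have "J \<longlonglongrightarrow> (LINT x:(\<Union>i. A i)|lebesgue. E x)"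
    unfolding J_def[abs_def] by (rule set_integral_cont_up[OF A inc]) (use int ul(1) A_def in auto)
  then show "(LINT x:S|lebesgue. E x) \<le> (2 * q - 1) powr q * Q"
    using J ul(1) unfolding A_def by (auto intro: LIMSEQ_le_const2)
qed

section \<open>Hoelder continuity of the transformed solution\<close>

lemma hoelder_const_eq: "hoelder_const q a b g = sqrt (2 * q - 1) * Q powr (1 / (2 * q))"
  by (simp add: hoelder_const_def Q_def)

lemma hoelder_const_nonneg: "hoelder_const q a b g \<ge> 0"
  using q by (simp add: hoelder_const_eq)

text \<open>Hoelder's inequality with exponent \<open>2 q\<close> for the derivative of \<open>G \<circ> f\<close> and the constant \<open>1\<close>.\<close>

lemma G_f_diff_le:
  assumes "x \<in> S" "y \<in> S" "x \<le> y"
  shows "\<bar>G (f y) - G (f x)\<bar> \<le> (y - x) powr (1 - 1 / (2 * q)) * hoelder_const q a b g"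
proof -
  have xy: "{x..y} \<subseteq> S" using Icc_subset assms by blast
  have m: "{x..y} \<in> sets lebesgue" by (simp add: fmeasurableD)
  define w where "w t = h (f t) powr (1 / (2 * q)) * deriv f t" for t
  \<comment> \<open>The exponent conjugate to \<open>2 q\<close>.\<close>
  define p' where "p' = 2 * q / (2 * q - 1)"
  have p': "1 < 2 * q" "p' > 1" "1 / (2 * q) + 1 / p' = 1" "1 / p' = 1 - 1 / (2 * q)"
    using q by (auto simp: p'_def field_simps)
  have "continuous_on S w"
    unfolding w_def using h_pos f_pos
    by (intro continuous_intros comp_f_cont[OF h_cont] f'_cont) (metis less_irrefl)
  then have wc: "continuous_on {x..y} w" using xy continuous_on_subset by blast
  have wi: "set_integrable lebesgue {x..y} w" using absolutely_integrable_continuous_real[OF wc] .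
  have "(w has_integral G (f y) - G (f x)) {x..y}"
  proof (rule fundamental_theorem_of_calculus[OF assms(3)])
    fix t assume "t \<in> {x..y}"
    then have "t \<in> S" using xy by blast
    then have "((\<lambda>t. G (f t)) has_real_derivative w t) (at t)"
      unfolding w_def by (intro DERIV_chain2[OF G_deriv[OF f_pos] f_deriv])
    then show "((\<lambda>t. G (f t)) has_vector_derivative w t) (at t within {x..y})"
      by (simp add: has_real_derivative_iff_has_vector_derivative has_vector_derivative_at_within)
  qed
  then have "G (f y) - G (f x) = (LINT t:{x..y}|lebesgue. w t)"
    using set_lebesgue_integral_eq_integral(2)[OF wi] by (simp add: integral_unique)
  then have "\<bar>G (f y) - G (f x)\<bar> \<le> (LINT t:{x..y}|lebesgue. \<bar>w t * 1\<bar>)"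
    using set_integral_norm_bound[OF wi] by simp
  also have "\<dots> \<le> (LINT t:{x..y}|lebesgue. \<bar>w t\<bar> powr (2 * q)) powr (1 / (2 * q)) *
      (LINT t:{x..y}|lebesgue. \<bar>1::real\<bar> powr p') powr (1 / p')"
  proof (rule Hoelder_inequality_set_integral(2)[OF p'(1-3)])
    show "set_borel_measurable lebesgue {x..y} w" by (rule set_borel_measurable_continuous[OF wc]) simp
    show "set_integrable lebesgue {x..y} (\<lambda>t. \<bar>w t\<bar> powr (2 * q))"
      using q by (intro absolutely_integrable_continuous_real continuous_on_powr' continuous_intros wc) auto
    show "set_borel_measurable lebesgue {x..y} (\<lambda>x. 1 :: real)"
      by (rule set_borel_measurable_continuous) auto
    show "set_integrable lebesgue {x..y} (\<lambda>t. \<bar>1::real\<bar> powr p')"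
      by (intro absolutely_integrable_continuous_real continuous_intros)
  qed
  also have "(LINT t:{x..y}|lebesgue. \<bar>1::real\<bar> powr p') = y - x"
    using assms(3) by (simp add: set_lebesgue_integral_def)
  also have "(LINT t:{x..y}|lebesgue. \<bar>w t\<bar> powr (2 * q)) = (LINT t:{x..y}|lebesgue. E t)"
  proof (rule set_lebesgue_integral_cong[OF m], intro allI impI)
    fix t assume "t \<in> {x..y}"
    then have "h (f t) > 0" using h_pos f_pos xy by blast
    then show "\<bar>w t\<bar> powr (2 * q) = E t" using q by (simp add: w_def E_def abs_mult powr_mult powr_powr)
  qed
  finally have 1: "\<bar>G (f y) - G (f x)\<bar>
      \<le> (LINT t:{x..y}|lebesgue. E t) powr (1 / (2 * q)) * (y - x) powr (1 - 1 / (2 * q))"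
    unfolding p'(4) .
  have "(LINT t:{x..y}|lebesgue. E t) powr (1 / (2 * q)) \<le> ((2 * q - 1) powr q * Q) powr (1 / (2 * q))"
  proof (rule powr_mono2)
    show "0 \<le> (LINT t:{x..y}|lebesgue. E t)"
      unfolding set_lebesgue_integral_def using xy E_nonneg
      by (intro Bochner_Integration.integral_nonneg) (auto simp: indicator_def)
  qed (use energy_bound_Icc[OF assms] q in auto)
  also have "((2 * q - 1) powr q * Q) powr (1 / (2 * q)) = hoelder_const q a b g"
    using q Q_nonneg by (simp add: hoelder_const_eq powr_mult powr_powr powr_half_sqrt)
  finally have "(LINT t:{x..y}|lebesgue. E t) powr (1 / (2 * q)) * (y - x) powr (1 - 1 / (2 * q))
      \<le> hoelder_const q a b g * (y - x) powr (1 - 1 / (2 * q))"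
    by (rule mult_right_mono) simp
  with 1 show ?thesis by (simp only: mult.commute)
qed

lemma G_f_hoelder:
  assumes "x \<in> S" "y \<in> S"
  shows "\<bar>G (f x) - G (f y)\<bar> \<le> \<bar>x - y\<bar> powr (1 - 1 / (2 * q)) * hoelder_const q a b g"
proof (cases "x \<le> y")
  case True
  then show ?thesis using G_f_diff_le[OF assms True] by (simp only: abs_minus_commute[of "G (f x)"] abs_minus_commute[of x] abs_of_nonneg diff_ge_0_iff_ge)
next
  case False
  then have "y \<le> x" by simp
  then show ?thesis using G_f_diff_le[OF assms(2,1) \<open>y \<le> x\<close>] by (simp only: abs_of_nonneg diff_ge_0_iff_ge)
qed

lemma G_cont: "continuous_on {0<..} G"
  using G_deriv by (meson DERIV_isCont continuous_at_imp_continuous_on greaterThan_iff)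

lemma G_less:
  assumes "0 < l" "l < m"
  shows "G l < G m"
proof (rule DERIV_pos_imp_increasing[OF \<open>l < m\<close>])
  fix x assume "l \<le> x"
  then have "x > 0" using \<open>0 < l\<close> by simp
  then show "\<exists>y. (G has_real_derivative y) (at x) \<and> y > 0"
    using G_deriv[of x] h_pos[of x] by (intro exI[of _ "h x powr (1 / (2 * q))"]) auto
qed

lemma G_less_iff: "0 < l \<Longrightarrow> 0 < m \<Longrightarrow> G l < G m \<longleftrightarrow> l < m"
  using G_less by (metis less_asym linorder_neqE_linordered_idom)

lemma G_inj: "inj_on G {0<..}"
  using G_less by (intro linorder_inj_onI) (auto, metis less_irrefl)

lemma abs_G_f_le:
  assumes "x \<in> S" "c \<in> S" "\<bar>x - c\<bar> \<le> d"
  shows "\<bar>G (f x)\<bar> \<le> G_bound q a b g (G (f c)) d"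
proof -
  have "\<bar>x - c\<bar> powr (1 - 1 / (2 * q)) * hoelder_const q a b g \<le> d powr (1 - 1 / (2 * q)) * hoelder_const q a b g"
    using assms(3) q hoelder_const_nonneg by (intro mult_right_mono powr_mono2) (auto simp: field_simps)
  then show ?thesis using G_f_hoelder[OF assms(1,2)] by (simp add: G_bound_def)
qed

lemma G_f_uniformly_continuous: "uniformly_continuous_on S (\<lambda>x. G (f x))"
  unfolding uniformly_continuous_on_def
proof (intro allI impI)
  fix e :: real assume "e > 0"
  define \<gamma> where "\<gamma> = 1 - 1 / (2 * q)"
  define N where "N = hoelder_const q a b g"
  have "\<gamma> > 0" using q by (simp add: \<gamma>_def field_simps)
  have "N \<ge> 0" using hoelder_const_nonneg by (simp add: N_def)
  define \<delta> where "\<delta> = (e / (N + 1)) powr (1 / \<gamma>)"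
  have "\<delta> > 0" using \<open>e > 0\<close> \<open>N \<ge> 0\<close> by (simp add: \<delta>_def)
  moreover have "dist (G (f y)) (G (f x)) < e" if "x \<in> S" "y \<in> S" "dist y x < \<delta>" for x y
  proof -
    have "\<bar>y - x\<bar> powr \<gamma> \<le> \<delta> powr \<gamma>"
      using that(3) \<open>\<gamma> > 0\<close> by (intro powr_mono2) (auto simp: dist_real_def)
    also have "\<dots> = e / (N + 1)"
      using \<open>e > 0\<close> \<open>N \<ge> 0\<close> \<open>\<gamma> > 0\<close> by (simp add: \<delta>_def powr_powr)
    finally have "\<bar>y - x\<bar> powr \<gamma> * N \<le> e / (N + 1) * N"
      using \<open>N \<ge> 0\<close> by (rule mult_right_mono)
    also have "\<dots> < e" using \<open>e > 0\<close> \<open>N \<ge> 0\<close> by (simp add: field_simps)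
    finally show ?thesis
      using G_f_hoelder[OF that(2,1)] by (simp add: dist_real_def \<gamma>_def N_def)
  qed
  ultimately show "\<exists>d>0. \<forall>x\<in>S. \<forall>x'\<in>S. dist x' x < d \<longrightarrow> dist (G (f x')) (G (f x)) < e" by blast
qed

section \<open>Extension to a finite end point\<close>

text \<open>If the limit \<open>L\<close> of \<open>G \<circ> f\<close> lies in the range of \<open>G\<close>, then \<open>f\<close> tends to the preimage of \<open>L\<close>. Otherwise \<open>L\<close> is
  the infimum of \<open>G\<close>, and \<open>f\<close> tends to \<open>0\<close>; the growth of \<open>G\<close> excludes that \<open>L\<close> is its supremum.\<close>

lemma limit_at_endpoint:
  assumes e: "e islimpt S"
    and sgn: "constant_sign_on {0<..} G" "strict_mono_on {0<..} (\<lambda>l. \<bar>G l\<bar>)"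
    and top: "filterlim (\<lambda>r. \<bar>G r\<bar>) at_top at_top"
  obtains l where "(f \<longlongrightarrow> l) (at e within S)" "((\<lambda>x. G (f x)) \<longlongrightarrow> G_ext0 G l) (at e within S)"
proof -
  have nt: "at e within S \<noteq> bot" using e trivial_limit_within by blast
  have G0: "G l > 0" if "l > 0" for l
  proof (rule ccontr)
    assume "\<not> G l > 0"
    then have "\<forall>x\<in>{0<..}. G x < 0"
      using sgn(1) that by (auto simp: constant_sign_on_def)
    then have "G 1 < 0" "G 2 < 0" by auto
    then show False using strict_mono_onD[OF sgn(2), of 1 2] G_less[of 1 2] by auto
  qed
  have inS: "eventually (\<lambda>x. x \<in> S) (at e within S)" by (simp add: eventually_at_filter)
  obtain L where L: "((\<lambda>x. G (f x)) \<longlongrightarrow> L) (at e within S)"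
    using uniformly_continuous_on_extension_at_closure[OF G_f_uniformly_continuous, of e]
      e by (auto simp: closure_def)
  show ?thesis
  proof (cases "\<exists>l0>0. G l0 \<le> L")
    case True
    then obtain l0 where l0: "l0 > 0" "G l0 \<le> L" by blast
    have "eventually (\<lambda>r. \<bar>G r\<bar> \<ge> L) at_top" using top by (simp add: filterlim_at_top)
    moreover have "eventually (\<lambda>r. r \<ge> l0) at_top" by (rule eventually_ge_at_top)
    ultimately have "eventually (\<lambda>r. \<bar>G r\<bar> \<ge> L \<and> r \<ge> l0) at_top" by (rule eventually_conj)
    then obtain r where r: "\<bar>G r\<bar> \<ge> L" "r \<ge> l0" by (auto simp: eventually_at_top_linorder)
    then have "G r \<ge> L" using G0[of r] l0 by simp
    moreover have "continuous_on {l0..r} G" using l0 by (intro continuous_on_subset[OF G_cont]) auto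
    ultimately obtain l where l: "l0 \<le> l" "G l = L" using IVT'[of G l0 L r] l0 r by auto
    then have "l > 0" using l0 by simp
    have "(f \<longlongrightarrow> l) (at e within S)"
    proof (rule order_tendstoI)
      fix y assume "y < l"
      show "eventually (\<lambda>x. y < f x) (at e within S)"
      proof (cases "y > 0")
        case True
        then have "G y < L" using G_less \<open>y < l\<close> l by blast
        then have "eventually (\<lambda>x. G y < G (f x)) (at e within S)" using L order_tendstoD(1) by blast
        then show ?thesis
          by (rule eventually_mono[OF eventually_conj[OF inS]]) (use True G_less_iff f_pos in blast)
      next
        case False
        then show ?thesis by (intro eventually_mono[OF inS]) (use f_pos in force)
      qed
    next
      fix y assume "l < y"
      then have "L < G y" using G_less \<open>l > 0\<close> l by blast
      then have "eventually (\<lambda>x. G (f x) < G y) (at e within S)" using L order_tendstoD(2) by blast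
      then show "eventually (\<lambda>x. f x < y) (at e within S)"
        by (rule eventually_mono[OF eventually_conj[OF inS]])
          (use \<open>l < y\<close> \<open>l > 0\<close> G_less_iff f_pos less_trans in blast)
    qed
    moreover have "G_ext0 G l = L" using l \<open>l > 0\<close> by (simp add: G_ext0_def)
    ultimately show ?thesis using L by (intro that[of l]) auto
  next
    case False
    then have below: "L < G y" if "y > 0" for y using that not_le by blast
    have "(f \<longlongrightarrow> 0) (at e within S)"
    proof (rule order_tendstoI)
      fix y :: real assume "y < 0"
      then show "eventually (\<lambda>x. y < f x) (at e within S)"
        by (intro eventually_mono[OF inS]) (use f_pos less_trans in blast)
    next
      fix y :: real assume "0 < y"
      then have "eventually (\<lambda>x. G (f x) < G y) (at e within S)" using below L order_tendstoD(2) by blast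
      then show "eventually (\<lambda>x. f x < y) (at e within S)"
        by (rule eventually_mono[OF eventually_conj[OF inS]]) (use \<open>0 < y\<close> G_less_iff f_pos in blast)
    qed
    moreover have "(G \<longlongrightarrow> L) (at_right 0)"
    proof (rule order_tendstoI)
      fix y assume "y < L"
      then have "y < G l" if "l > 0" for l using below[OF that] by simp
      then show "eventually (\<lambda>l. y < G l) (at_right 0)" by (auto simp: eventually_at_filter)
    next
      fix y assume "L < y"
      then have "eventually (\<lambda>x. G (f x) < y) (at e within S)" using L order_tendstoD(2) by blast
      then have "eventually (\<lambda>x. x \<in> S \<and> G (f x) < y) (at e within S)" using inS by (rule eventually_conj[rotated])
      then obtain x where x: "x \<in> S" "G (f x) < y" using eventually_happens'[OF nt] by blast
      have "G l < y" if "0 < l" "l < f x" for l using G_less[OF that] x by simp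
      then show "eventually (\<lambda>l. G l < y) (at_right 0)"
        using f_pos[OF x(1)] eventually_at_right_field by blast
    qed
    then have "G_ext0 G 0 = L" by (simp add: G_ext0_def tendsto_Lim)
    ultimately show ?thesis using L by (intro that[of 0]) auto
  qed
qed

lemma extension_to_endpoint:
  assumes e: "e islimpt S" "e \<notin> S"
    and sgn: "constant_sign_on {0<..} G" "strict_mono_on {0<..} (\<lambda>l. \<bar>G l\<bar>)"
    and top: "filterlim (\<lambda>r. \<bar>G r\<bar>) at_top at_top"
  shows "\<exists>ft. continuous_on (insert e S) ft \<and> (\<forall>x\<in>S. ft x = f x) \<and>
    (\<forall>x\<in>S. ereal \<bar>f x\<bar> \<le> abs_inv G (G_bound q a b g (G_ext0 G (ft e)) \<bar>x - e\<bar>))"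
proof -
  obtain l where l: "(f \<longlongrightarrow> l) (at e within S)" "((\<lambda>x. G (f x)) \<longlongrightarrow> G_ext0 G l) (at e within S)"
    using limit_at_endpoint[OF e(1) sgn top] .
  have nt: "at e within S \<noteq> bot" using e trivial_limit_within by blast
  have inS: "eventually (\<lambda>x. x \<in> S) (at e within S)" by (simp add: eventually_at_filter)
  define ft where "ft x = (if x = e then l else f x)" for x
  have "continuous_on (insert e S) ft"
    unfolding continuous_on_def
  proof (intro ballI)
    fix x assume x: "x \<in> insert e S"
    show "(ft \<longlongrightarrow> ft x) (at x within insert e S)"
    proof (cases "x = e")
      case True
      have "(ft \<longlongrightarrow> l) (at e within S)"
        by (rule Lim_transform_eventually[OF l(1)]) (auto simp: eventually_at_filter ft_def)
      moreover have "at e within insert e S = at e within S" by (simp add: at_within_def)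
      ultimately show ?thesis using True by (simp add: ft_def)
    next
      case False
      then have "x \<in> S" using x by simp
      then have "isCont f x" using f_deriv DERIV_isCont by blast
      then have "(f \<longlongrightarrow> f x) (at x)" by (simp add: isCont_def)
      moreover have "eventually (\<lambda>y. f y = ft y) (at x)"
        using \<open>x \<in> S\<close> e(2) by (auto simp: eventually_at_topological ft_def intro!: exI[of _ S])
      ultimately have "(ft \<longlongrightarrow> f x) (at x)" by (rule Lim_transform_eventually)
      then show ?thesis using False by (simp add: ft_def Lim_at_imp_Lim_at_within)
    qed
  qed
  moreover have "ft x = f x" if "x \<in> S" for x using that e(2) by (auto simp: ft_def)
  moreover have "ereal \<bar>f x\<bar> \<le> abs_inv G (G_bound q a b g (G_ext0 G (ft e)) \<bar>x - e\<bar>)" if x: "x \<in> S" for x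
  proof (rule le_abs_inv[OF G_cont sgn(2) f_pos[OF x]])
    have "x \<noteq> e" using x e(2) by auto
    have "((\<lambda>c. G_bound q a b g (G (f c)) \<bar>x - c\<bar>) \<longlongrightarrow> G_bound q a b g (G_ext0 G l) \<bar>x - e\<bar>) (at e within S)"
      unfolding G_bound_def using \<open>x \<noteq> e\<close> by (intro tendsto_intros l(2)) auto
    moreover have "eventually (\<lambda>c. \<bar>G (f x)\<bar> \<le> G_bound q a b g (G (f c)) \<bar>x - c\<bar>) (at e within S)"
      by (intro eventually_mono[OF inS] abs_G_f_le x) auto
    ultimately have "\<bar>G (f x)\<bar> \<le> G_bound q a b g (G_ext0 G l) \<bar>x - e\<bar>"
      using nt tendsto_lowerbound by blast
    then show "\<bar>G (f x)\<bar> \<le> G_bound q a b g (G_ext0 G (ft e)) \<bar>x - e\<bar>" by (simp add: ft_def)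
  qed
  ultimately show ?thesis by blast
qed

section \<open>Bounds for the second derivative\<close>

text \<open>First a bounded interval on which \<open>\<tau> \<circ> f\<close> is bounded by some constant \<open>T\<close>.\<close>

context
  fixes u v T :: real
  assumes uv: "u < v" "{u<..<v} \<subseteq> S" and T: "\<And>t. t \<in> {u<..<v} \<Longrightarrow> \<tau> (f t) \<le> T"
begin

text \<open>The bounded interval.\<close>

abbreviation "I \<equiv> {u<..<v}"

lemma I_meas: "I \<in> sets lebesgue" "I \<in> lmeasurable"
  by (simp_all add: fmeasurableD)

lemma \<tau>_f_nonneg: "t \<in> I \<Longrightarrow> 0 \<le> \<tau> (f t)"
  using uv \<tau>_pos f_pos by (meson less_imp_le subsetD)

lemma \<tau>_f_cont: "continuous_on I (\<lambda>t. \<tau> (f t))"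
  using comp_f_cont[OF \<tau>_cont] uv continuous_on_subset by blast

lemma rhs_integrable: "set_integrable lebesgue I (\<lambda>t. \<tau> (f t) * g t)"
proof (rule absolutely_integrable_bounded_measurable_product_real)
  show "(\<lambda>t. \<tau> (f t)) \<in> borel_measurable (lebesgue_on I)"
    by (rule continuous_imp_measurable_on_sets_lebesgue[OF \<tau>_f_cont I_meas(1)])
  show "bounded ((\<lambda>t. \<tau> (f t)) ` I)"
    using T \<tau>_f_nonneg by (intro boundedI[of _ T]) auto
  show "set_integrable lebesgue I g" by (rule g_integrable[OF I_meas(2) uv(2)])
qed (rule I_meas)

lemma rhs_powr_integrable: "set_integrable lebesgue I (\<lambda>t. \<tau> (f t) powr q * \<bar>g t\<bar> powr q)"
proof (rule absolutely_integrable_bounded_measurable_product_real)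
  have "continuous_on I (\<lambda>t. \<tau> (f t) powr q)"
    using \<tau>_f_nonneg q by (intro continuous_on_powr' \<tau>_f_cont continuous_intros) auto
  then show "(\<lambda>t. \<tau> (f t) powr q) \<in> borel_measurable (lebesgue_on I)"
    by (rule continuous_imp_measurable_on_sets_lebesgue[OF _ I_meas(1)])
  show "bounded ((\<lambda>t. \<tau> (f t) powr q) ` I)"
    using T \<tau>_f_nonneg q by (intro boundedI[of _ "T powr q"]) (auto intro!: powr_mono2)
  show "set_integrable lebesgue I (\<lambda>t. \<bar>g t\<bar> powr q)" by (rule Q_mono(1)[OF I_meas(1) uv(2)])
qed (rule I_meas)

lemma f''_integrals:
  shows "set_integrable lebesgue I (deriv (deriv f))"
    and "set_integrable lebesgue I (\<lambda>t. \<bar>deriv (deriv f) t\<bar> powr q)"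
    and "(LINT t:I|lebesgue. \<bar>deriv (deriv f) t\<bar> powr q) \<le> T powr q * (LINT t:I|lebesgue. \<bar>g t\<bar> powr q)"
proof -
  obtain N where N: "negligible N"
    "\<And>x. x \<in> S \<Longrightarrow> x \<notin> N \<Longrightarrow> (deriv f has_real_derivative g x * \<tau> (f x)) (at x)"
    using ode_exceptional_set by blast
  have f'': "deriv (deriv f) t = \<tau> (f t) * g t" if "t \<in> I - N" for t
    using DERIV_imp_deriv[OF N(2)] that uv by auto
  then have pw: "\<bar>deriv (deriv f) t\<bar> powr q = \<tau> (f t) powr q * \<bar>g t\<bar> powr q" if "t \<in> I - N" for t
    using \<tau>_f_nonneg[of t] that by (simp add: abs_mult powr_mult)
  show "set_integrable lebesgue I (deriv (deriv f))"
    using f'' by (rule absolutely_integrable_spike[OF rhs_integrable N(1)])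
  show int: "set_integrable lebesgue I (\<lambda>t. \<bar>deriv (deriv f) t\<bar> powr q)"
    using pw by (rule absolutely_integrable_spike[OF rhs_powr_integrable N(1)])
  have "(LINT t:I|lebesgue. \<bar>deriv (deriv f) t\<bar> powr q) = integral I (\<lambda>t. \<bar>deriv (deriv f) t\<bar> powr q)"
    by (rule set_lebesgue_integral_eq_integral(2)[OF int])
  also have "\<dots> = integral I (\<lambda>t. \<tau> (f t) powr q * \<bar>g t\<bar> powr q)"
    using pw by (intro integral_spike[OF N(1)]) simp
  also have "\<dots> = (LINT t:I|lebesgue. \<tau> (f t) powr q * \<bar>g t\<bar> powr q)"
    by (rule set_lebesgue_integral_eq_integral(2)[symmetric, OF rhs_powr_integrable])
  also have "\<dots> \<le> (LINT t:I|lebesgue. T powr q * \<bar>g t\<bar> powr q)"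
    using T \<tau>_f_nonneg q
    by (intro set_integral_mono rhs_powr_integrable set_integrable_mult_right Q_mono(1)[OF I_meas(1) uv(2)])
      (auto intro!: mult_right_mono powr_mono2)
  finally show "(LINT t:I|lebesgue. \<bar>deriv (deriv f) t\<bar> powr q) \<le> T powr q * (LINT t:I|lebesgue. \<bar>g t\<bar> powr q)"
    by simp
qed

text \<open>As \<open>f'' = g \<tau>(f)\<close> is integrable over the bounded interval, \<open>f'\<close> and then \<open>f\<close> are bounded there.\<close>

lemma W2q_on_I: "W2q_on q I f"
proof -
  obtain N where N: "negligible N"
    "\<And>x. x \<in> S \<Longrightarrow> x \<notin> N \<Longrightarrow> (deriv f has_real_derivative g x * \<tau> (f x)) (at x)"
    using ode_exceptional_set by blast
  define B where "B = (LINT t:I|lebesgue. \<bar>\<tau> (f t) * g t\<bar>)"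
  have incr: "\<bar>deriv f t - deriv f s\<bar> \<le> B" if st: "s \<in> I" "t \<in> I" "s \<le> t" for s t
  proof -
    have sub: "{s..t} \<subseteq> I" using st by auto
    have m: "{s..t} \<in> sets lebesgue" by (simp add: fmeasurableD)
    have int: "set_integrable lebesgue {s..t} (\<lambda>t. \<tau> (f t) * g t)"
      by (rule set_integrable_subset[OF rhs_integrable m sub])
    have "((\<lambda>t. \<tau> (f t) * g t) has_integral deriv f t - deriv f s) {s..t}"
    proof (rule absolutely_continuous_on_has_integral[OF st(3) f'_ac N(1)])
      show "{s..t} \<subseteq> S" using sub uv by blast
      fix x assume "x \<in> {s..t} - N"
      then have "(deriv f has_real_derivative g x * \<tau> (f x)) (at x)"
        using N(2) sub uv by blast
      then show "(deriv f has_vector_derivative \<tau> (f x) * g x) (at x within {s..t})"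
        by (simp add: has_real_derivative_iff_has_vector_derivative has_vector_derivative_at_within mult.commute)
    qed
    then have "deriv f t - deriv f s = (LINT t:{s..t}|lebesgue. \<tau> (f t) * g t)"
      using set_lebesgue_integral_eq_integral(2)[OF int] by (simp add: integral_unique)
    then have "\<bar>deriv f t - deriv f s\<bar> \<le> (LINT t:{s..t}|lebesgue. \<bar>\<tau> (f t) * g t\<bar>)"
      using set_integral_norm_bound[OF int] by simp
    also have "\<dots> \<le> B"
      unfolding B_def by (rule set_integral_mono_set[OF set_integrable_abs[OF rhs_integrable] m sub]) simp
    finally show ?thesis .
  qed
  obtain c where c: "c \<in> I" using dense[OF uv(1)] by auto
  define B1 where "B1 = \<bar>deriv f c\<bar> + B"
  have f'_bound: "\<bar>deriv f t\<bar> \<le> B1" if "t \<in> I" for t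
    using incr[of c t] incr[of t c] that c unfolding B1_def by (cases "c \<le> t") auto
  then have "B1 \<ge> 0" using c by force
  have f_bound: "\<bar>f t\<bar> \<le> \<bar>f c\<bar> + B1 * (v - u)" if t: "t \<in> I" for t
  proof -
    have "norm (f t - f c) \<le> B1 * norm (t - c)"
    proof (rule field_differentiable_bound[of I f "deriv f"])
      show "(f has_real_derivative deriv f x) (at x within I)" if "x \<in> I" for x
        using f_deriv that uv by (blast intro: has_field_derivative_at_within)
    qed (use f'_bound t c in auto)
    also have "\<dots> \<le> B1 * (v - u)" using t c \<open>B1 \<ge> 0\<close> by (intro mult_left_mono) auto
    finally show ?thesis by simp
  qed
  have q0: "0 < q" using q by simp
  have "Lq_on q I f"
    using q0 f_bound continuous_on_subset[OF f_cont uv(2)] by (intro Lq_on_bounded)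
  moreover have "Lq_on q I (deriv f)"
    using q0 f'_bound continuous_on_subset[OF f'_cont uv(2)] by (intro Lq_on_bounded)
  moreover have "Lq_on q I (deriv (deriv f))"
    using f''_integrals(1,2)
    by (simp add: Lq_on_def set_borel_measurable_def set_integrable_def borel_measurable_integrable)
  moreover have "W21_loc_on I f"
    using f_W uv(2) by (auto simp: W21_loc_on_def locally_absolutely_continuous_on_def)
  ultimately show ?thesis by (simp add: W2q_on_def)
qed

end

lemma tau_G_inv_G_f: "t \<in> S \<Longrightarrow> tau_G_inv \<tau> G (G (f t)) = \<tau> (f t)"
  using f_pos[of t] by (simp add: tau_G_inv_def the_inv_into_f_f[OF G_inj])

lemma tau_G_inv_bdd_above:
  assumes "proper_tau_G_inv \<tau> G"
  shows "bdd_above (tau_G_inv \<tau> G ` ({- A<..<A} \<inter> G ` {0<..}))"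
proof (rule bounded_imp_bdd_above)
  show "bounded (tau_G_inv \<tau> G ` ({- A<..<A} \<inter> G ` {0<..}))"
    using assms unfolding proper_tau_G_inv_def
    by (elim allE impE) (auto intro!: boundedI[of _ A])
qed

lemma \<tau>_f_le_sup:
  assumes "proper_tau_G_inv \<tau> G" "t \<in> S" "\<bar>G (f t)\<bar> < A"
  shows "\<tau> (f t) \<le> sup_tau_G_inv \<tau> G A"
proof -
  have "tau_G_inv \<tau> G (G (f t)) \<le> sup_tau_G_inv \<tau> G A"
    unfolding sup_tau_G_inv_def
    by (rule cSUP_upper[OF _ tau_G_inv_bdd_above[OF assms(1)]]) (use assms f_pos in auto)
  then show ?thesis by (simp add: tau_G_inv_G_f[OF assms(2)])
qed

text \<open>For interior points \<open>t\<close> the distance to \<open>c\<close> is less than the maximum below, so \<open>\<bar>G(f(t))\<bar>\<close> is strictly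
  less than the bound unless \<open>g = 0\<close> almost everywhere; this is why the supremum over an open interval
  suffices.\<close>

lemma second_derivative_bound:
  assumes proper: "proper_tau_G_inv \<tau> G" and uv: "u < v" "{u<..<v} \<subseteq> S"
  shows "W2q_on q {u<..<v} f \<and> (\<forall>c\<in>{u<..<v}.
     (LINT t:{u<..<v}|lebesgue. \<bar>deriv (deriv f) t\<bar> powr q) powr (1 / q)
     \<le> sup_tau_G_inv \<tau> G (G_bound q a b g (G (f c)) (max \<bar>c - u\<bar> \<bar>v - c\<bar>))
       * (LINT t:{u<..<v}|lebesgue. \<bar>g t\<bar> powr q) powr (1 / q))"
proof (intro conjI ballI)
  let ?I = "{u<..<v}"
  define A where "A c = G_bound q a b g (G (f c)) (max \<bar>c - u\<bar> \<bar>v - c\<bar>)" for c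
  have le: "\<bar>G (f t)\<bar> \<le> A c" if "t \<in> ?I" "c \<in> ?I" for t c
    unfolding A_def using that uv by (intro abs_G_f_le) auto
  \<comment> \<open>The summand \<open>1\<close> makes the inequality strict also if \<open>Q = 0\<close>.\<close>
  have T: "\<tau> (f t) \<le> sup_tau_G_inv \<tau> G (A c + 1)" if "t \<in> ?I" "c \<in> ?I" for t c
    using le[OF that] that uv by (intro \<tau>_f_le_sup[OF proper]) auto
  obtain c0 where c0: "c0 \<in> ?I" using dense[OF uv(1)] by auto
  show "W2q_on q ?I f" using W2q_on_I[OF uv T[OF _ c0]] .
  fix c assume c: "c \<in> ?I"
  have m: "?I \<in> sets lebesgue" by (simp add: fmeasurableD)
  have nonneg: "0 \<le> (LINT t:?I|lebesgue. \<bar>w t\<bar> powr q)" for w :: "real \<Rightarrow> real"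
    unfolding set_lebesgue_integral_def by (intro Bochner_Integration.integral_nonneg) auto
  show "(LINT t:?I|lebesgue. \<bar>deriv (deriv f) t\<bar> powr q) powr (1 / q)
     \<le> sup_tau_G_inv \<tau> G (G_bound q a b g (G (f c)) (max \<bar>c - u\<bar> \<bar>v - c\<bar>))
       * (LINT t:?I|lebesgue. \<bar>g t\<bar> powr q) powr (1 / q)"
    unfolding A_def[symmetric]
  proof (cases "Q = 0")
    case True
    then have "(LINT t:?I|lebesgue. \<bar>g t\<bar> powr q) = 0"
      using Q_mono(2)[OF m uv(2)] nonneg[of g] by simp
    moreover from this have "(LINT t:?I|lebesgue. \<bar>deriv (deriv f) t\<bar> powr q) = 0"
      using f''_integrals(3)[OF uv T[OF _ c0]] nonneg[of "deriv (deriv f)"] by simp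
    ultimately show "(LINT t:?I|lebesgue. \<bar>deriv (deriv f) t\<bar> powr q) powr (1 / q)
       \<le> sup_tau_G_inv \<tau> G (A c) * (LINT t:?I|lebesgue. \<bar>g t\<bar> powr q) powr (1 / q)" by simp
  next
    case False
    then have N: "hoelder_const q a b g > 0"
      using Q_nonneg q by (simp add: hoelder_const_eq)
    have less: "\<bar>G (f t)\<bar> < A c" if t: "t \<in> ?I" for t
    proof -
      have "\<bar>t - c\<bar> powr (1 - 1 / (2 * q)) < max \<bar>c - u\<bar> \<bar>v - c\<bar> powr (1 - 1 / (2 * q))"
        using t c q by (intro powr_less_mono2) (auto simp: field_simps)
      then have "\<bar>t - c\<bar> powr (1 - 1 / (2 * q)) * hoelder_const q a b g
          < max \<bar>c - u\<bar> \<bar>v - c\<bar> powr (1 - 1 / (2 * q)) * hoelder_const q a b g"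
        using N by (rule mult_strict_right_mono)
      moreover have "\<bar>G (f t) - G (f c)\<bar> \<le> \<bar>t - c\<bar> powr (1 - 1 / (2 * q)) * hoelder_const q a b g"
        using t c uv by (intro G_f_hoelder) auto
      ultimately show ?thesis unfolding A_def G_bound_def by linarith
    qed
    define D where "D = sup_tau_G_inv \<tau> G (A c)"
    have D: "\<tau> (f t) \<le> D" if "t \<in> ?I" for t
      unfolding D_def using less[OF that] that uv by (intro \<tau>_f_le_sup[OF proper]) auto
    have "D \<ge> 0" using D[OF c] \<tau>_pos f_pos c uv by (meson less_imp_le order_trans subsetD)
    have "(LINT t:?I|lebesgue. \<bar>deriv (deriv f) t\<bar> powr q) powr (1 / q)
        \<le> (D powr q * (LINT t:?I|lebesgue. \<bar>g t\<bar> powr q)) powr (1 / q)"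
      using f''_integrals(3)[OF uv D] nonneg q by (intro powr_mono2) auto
    also have "\<dots> = D * (LINT t:?I|lebesgue. \<bar>g t\<bar> powr q) powr (1 / q)"
      using \<open>D \<ge> 0\<close> nonneg[of g] q by (simp add: powr_mult powr_powr)
    finally show "(LINT t:?I|lebesgue. \<bar>deriv (deriv f) t\<bar> powr q) powr (1 / q)
       \<le> sup_tau_G_inv \<tau> G (A c) * (LINT t:?I|lebesgue. \<bar>g t\<bar> powr q) powr (1 / q)" by (simp add: D_def)
  qed
qed

end

section \<open>The transforms of \<open>\<tau>\<close>\<close>

lemma constant_sign_on_sgn:
  assumes "constant_sign_on A F"
  obtains s :: real where "\<bar>s\<bar> = 1" "\<And>x. x \<in> A \<Longrightarrow> sgn (F x) = s" "\<And>x. x \<in> A \<Longrightarrow> F x = s * \<bar>F x\<bar>"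
    "\<And>x. x \<in> A \<Longrightarrow> F x \<noteq> 0"
proof -
  consider "\<forall>x\<in>A. F x > 0" | "\<forall>x\<in>A. F x < 0"
    using assms by (auto simp: constant_sign_on_def)
  then show ?thesis
  proof cases
    case 1
    then show ?thesis by (intro that[of 1]) (auto dest: bspec)
  next
    case 2
    then show ?thesis by (intro that[of "-1"]) (auto dest: bspec)
  qed
qed

text \<open>The next two lemmas establish the relations between the transforms for \<open>q = 1\<close> and for \<open>q > 1\<close>. The
  exponent \<open>1 - 1 / 1\<close> in the first is \<open>1 - 1 / q\<close>.\<close>

lemma transforms_q_eq_1:
  fixes \<tau> K :: "real \<Rightarrow> real"
  assumes pos: "\<And>l. l > 0 \<Longrightarrow> \<tau> l > 0"
    and diff: "\<And>l. l > 0 \<Longrightarrow> \<tau> field_differentiable (at l)"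
    and cont: "continuous_on {0<..} (deriv \<tau>)" and sgn: "constant_sign_on {0<..} (deriv \<tau>)"
  shows "l > 0 \<Longrightarrow> (H_tr 1 \<tau> K has_real_derivative h_tr 1 \<tau> K l) (at l)"
    and "l > 0 \<Longrightarrow> h_tr 1 \<tau> K l > 0"
    and "continuous_on {0<..} (h_tr 1 \<tau> K)"
    and "l > 0 \<Longrightarrow> \<tau> l * \<bar>H_tr 1 \<tau> K l\<bar> = h_tr 1 \<tau> K l powr (1 - 1 / 1)"
proof -
  obtain s :: real where s: "\<bar>s\<bar> = 1" "\<And>x. x > 0 \<Longrightarrow> sgn (deriv \<tau> x) = s"
    "\<And>x. x > 0 \<Longrightarrow> deriv \<tau> x = s * \<bar>deriv \<tau> x\<bar>" "\<And>x. x > 0 \<Longrightarrow> deriv \<tau> x \<noteq> 0"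
    by (rule constant_sign_on_sgn[OF sgn, unfolded greaterThan_iff]) blast
  have ss: "s * s = 1" using abs_mult_self_eq[of s] s(1) by simp
  have der: "(\<tau> has_real_derivative deriv \<tau> l) (at l)" if "l > 0" for l
    using diff[OF that] by (simp add: DERIV_deriv_iff_field_differentiable)
  have nz: "\<tau> l \<noteq> 0" if "l > 0" for l using pos[OF that] by simp
  have contt: "continuous_on {0<..} \<tau>"
    using der by (meson DERIV_isCont continuous_at_imp_continuous_on greaterThan_iff)
  show h: "h_tr 1 \<tau> K l > 0" if "l > 0" for l
    using s(4)[OF that] pos[OF that] by (simp add: h_tr_def)
  show "(H_tr 1 \<tau> K has_real_derivative h_tr 1 \<tau> K l) (at l)" if "l > 0" for l
  proof (rule has_field_derivative_transform_within_open[of "\<lambda>l. - s / \<tau> l" _ _ "{0<..}"])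
    have "((\<lambda>l. - s / \<tau> l) has_real_derivative s * deriv \<tau> l / (\<tau> l)\<^sup>2) (at l)"
      using pos[OF that] by (auto intro!: derivative_eq_intros der[OF that] simp: power2_eq_square)
    also have "s * deriv \<tau> l / (\<tau> l)\<^sup>2 = h_tr 1 \<tau> K l"
      using ss by (subst s(3)[OF that]) (simp add: h_tr_def flip: mult.assoc)
    finally show "((\<lambda>l. - s / \<tau> l) has_real_derivative h_tr 1 \<tau> K l) (at l)" .
  qed (use that s(2) in \<open>auto simp: H_tr_def\<close>)
  have "continuous_on {0<..} (\<lambda>l. \<bar>deriv \<tau> l\<bar> / (\<tau> l)\<^sup>2)"
    using nz by (intro continuous_intros cont contt) auto
  then show "continuous_on {0<..} (h_tr 1 \<tau> K)" by (simp add: h_tr_def[abs_def])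
  show "\<tau> l * \<bar>H_tr 1 \<tau> K l\<bar> = h_tr 1 \<tau> K l powr (1 - 1 / 1)" if "l > 0" for l
    using h[OF that] pos[OF that] s(1) s(2)[OF that] by (simp add: H_tr_def abs_divide)
qed

lemma transforms_q_gt_1:
  fixes \<tau> K :: "real \<Rightarrow> real"
  assumes q: "q > 1" and pos: "\<And>l. l > 0 \<Longrightarrow> \<tau> l > 0" and cont: "continuous_on {0<..} \<tau>"
    and K: "ac_primitive_on {0<..} (k_tr q \<tau>) K" and sgn: "constant_sign_on {0<..} K"
  shows "l > 0 \<Longrightarrow> (H_tr q \<tau> K has_real_derivative h_tr q \<tau> K l) (at l)"
    and "l > 0 \<Longrightarrow> h_tr q \<tau> K l > 0"
    and "continuous_on {0<..} (h_tr q \<tau> K)"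
    and "l > 0 \<Longrightarrow> \<tau> l * \<bar>H_tr q \<tau> K l\<bar> = h_tr q \<tau> K l powr (1 - 1 / q)"
proof -
  obtain s :: real where s: "\<bar>s\<bar> = 1" "\<And>x. x > 0 \<Longrightarrow> sgn (K x) = s"
    "\<And>x. x > 0 \<Longrightarrow> K x = s * \<bar>K x\<bar>" "\<And>x. x > 0 \<Longrightarrow> K x \<noteq> 0"
    by (rule constant_sign_on_sgn[OF sgn, unfolded greaterThan_iff]) blast
  have ss: "s * s = 1" using abs_mult_self_eq[of s] s(1) by simp
  have sK: "s * K x = \<bar>K x\<bar>" if "x > 0" for x
    using ss by (subst s(3)[OF that]) (simp flip: mult.assoc)
  have kcont: "continuous_on {0<..} (k_tr q \<tau>)"
  proof -
    have "\<tau> l \<noteq> 0" if "l > 0" for l using pos[OF that] by simp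
    then show ?thesis unfolding k_tr_def by (intro continuous_on_powr continuous_intros cont) auto
  qed
  have kpos: "k_tr q \<tau> l > 0" if "l > 0" for l using pos[OF that] by (simp add: k_tr_def)
  have der: "(K has_real_derivative k_tr q \<tau> l) (at l)" if "l > 0" for l
    using ac_primitive_on_continuous_imp_DERIV[OF K _ kcont] that by simp
  have Kcont: "continuous_on {0<..} K"
    using der by (meson DERIV_isCont continuous_at_imp_continuous_on greaterThan_iff)
  have h_eq: "h_tr q \<tau> K l = (q - 1) powr q * \<bar>K l\<bar> powr (- q) * k_tr q \<tau> l" for l
    using q by (simp add: h_tr_def)
  have H_eq: "H_tr q \<tau> K l = - sgn (K l) * (q - 1) powr (q - 1) * \<bar>K l\<bar> powr (1 - q)" for l
    using q by (simp add: H_tr_def)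
  show "h_tr q \<tau> K l > 0" if "l > 0" for l
    using q kpos[OF that] s(4)[OF that] by (simp add: h_eq)
  have "continuous_on {0<..} (\<lambda>l. (q - 1) powr q * \<bar>K l\<bar> powr (- q) * k_tr q \<tau> l)"
    using s(4) by (intro continuous_intros Kcont kcont) auto
  then show "continuous_on {0<..} (h_tr q \<tau> K)" by (simp add: h_eq[abs_def])
  show "(H_tr q \<tau> K has_real_derivative h_tr q \<tau> K l) (at l)" if "l > 0" for l
  proof (rule has_field_derivative_transform_within_open
      [of "\<lambda>l. - s * (q - 1) powr (q - 1) * (s * K l) powr (1 - q)" _ _ "{0<..}"])
    have sKpos: "s * K l > 0" using sK[OF that] s(4)[OF that] by simp
    have "((\<lambda>l. s * K l) has_real_derivative s * k_tr q \<tau> l) (at l)"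
      by (auto intro!: derivative_eq_intros der[OF that])
    then have "((\<lambda>l. (s * K l) powr (1 - q)) has_real_derivative
        (1 - q) * (s * K l) powr (1 - q - 1) * (s * k_tr q \<tau> l)) (at l)"
      using sKpos by (intro DERIV_chain2[OF has_real_derivative_powr])
    then have "((\<lambda>l. - s * (q - 1) powr (q - 1) * (s * K l) powr (1 - q)) has_real_derivative
        - s * (q - 1) powr (q - 1) * ((1 - q) * (s * K l) powr (1 - q - 1) * (s * k_tr q \<tau> l))) (at l)"
      by (rule DERIV_cmult)
    also have "- s * (q - 1) powr (q - 1) * ((1 - q) * (s * K l) powr (1 - q - 1) * (s * k_tr q \<tau> l))
       = (s * s) * (((q - 1) * (q - 1) powr (q - 1)) * (s * K l) powr (- q) * k_tr q \<tau> l)"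
      by (simp add: algebra_simps)
    also have "(q - 1) * (q - 1) powr (q - 1) = (q - 1) powr q"
      using q by (simp add: powr_mult_base)
    finally show "((\<lambda>l. - s * (q - 1) powr (q - 1) * (s * K l) powr (1 - q)) has_real_derivative h_tr q \<tau> K l) (at l)"
      using ss sK[OF that] by (simp add: h_eq)
  qed (use that s(2) sK in \<open>auto simp: H_eq\<close>)
  show "\<tau> l * \<bar>H_tr q \<tau> K l\<bar> = h_tr q \<tau> K l powr (1 - 1 / q)" if "l > 0" for l
  proof -
    have "h_tr q \<tau> K l powr (1 - 1 / q) = (q - 1) powr (q * (1 - 1 / q)) * \<bar>K l\<bar> powr (- q * (1 - 1 / q))
       * \<tau> l powr (q / (q - 1) * (1 - 1 / q))"
      using q by (simp only: h_eq powr_mult powr_powr k_tr_def powr_ge_zero)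
    also have "q * (1 - 1 / q) = q - 1" using q by (simp add: field_simps)
    also have "- q * (1 - 1 / q) = 1 - q" using q by (simp add: field_simps)
    also have "q / (q - 1) * (1 - 1 / q) = 1" using q by (simp add: field_simps)
    finally show ?thesis
      using s(1) s(2)[OF that] pos[OF that] by (simp add: H_eq abs_mult)
  qed
qed

theorem proposition7p1:
  fixes q :: real and a b :: ereal and g \<tau> K G f :: "real \<Rightarrow> real"
  assumes q: "1 \<le> q" and ab: "a < b"
    and g: "Lq_on q (einterval a b) g"
    and \<tau>_pos: "\<forall>l>0. \<tau> l > 0" and \<tau>_cont: "continuous_on {0<..} \<tau>"
    and \<tau>_q_eq_1: "q = 1 \<Longrightarrow> (\<forall>l>0. \<tau> field_differentiable (at l)) \<and>
           continuous_on {0<..} (deriv \<tau>) \<and> constant_sign_on {0<..} (deriv \<tau>)"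
    and K: "q > 1 \<Longrightarrow> ac_primitive_on {0<..} (k_tr q \<tau>) K \<and> constant_sign_on {0<..} K"
    and G: "ac_primitive_on {0<..} (\<lambda>l. h_tr q \<tau> K l powr (1 / (2 * q))) G"
    and f_W: "W21_loc_on (einterval a b) f"
    and f_pos: "\<forall>x\<in>einterval a b. f x > 0"
    and ode: "AE x in lebesgue. x \<in> einterval a b \<longrightarrow>
           (deriv f has_real_derivative g x * \<tau> (f x)) (at x)"
    and boundary:
      "Liminf (at_left b) (\<lambda>R. ereal ((\<lambda>x. \<bar>deriv f x\<bar> powr (2 * q - 2) * deriv f x
           * H_tr q \<tau> K (f x)) (real_of_ereal R)))
       - Limsup (at_right a) (\<lambda>r. ereal ((\<lambda>x. \<bar>deriv f x\<bar> powr (2 * q - 2) * deriv f x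
           * H_tr q \<tau> K (f x)) (real_of_ereal r))) \<le> 0"
  shows
   "(set_integrable lebesgue (einterval a b)
        (\<lambda>x. \<bar>deriv f x\<bar> powr (2 * q) * h_tr q \<tau> K (f x)) \<and>
     (LINT x:einterval a b|lebesgue. \<bar>deriv f x\<bar> powr (2 * q) * h_tr q \<tau> K (f x))
       \<le> sqrt (2 * q - 1) powr (2 * q) * (LINT x:einterval a b|lebesgue. \<bar>g x\<bar> powr q)) \<and>
    (hoelder_continuous_on (1 - 1 / (2 * q)) (einterval a b) (\<lambda>x. G (f x)) \<and>
     (SUP (x, y) \<in> {(x, y). x \<in> einterval a b \<and> y \<in> einterval a b \<and> x \<noteq> y}.
         ereal (\<bar>G (f x) - G (f y)\<bar> / \<bar>x - y\<bar> powr (1 - 1 / (2 * q))))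
       \<le> ereal (sqrt (2 * q - 1) *
           (LINT x:einterval a b|lebesgue. \<bar>g x\<bar> powr q) powr (1 / (2 * q)))) \<and>
    (constant_sign_on {0<..} G \<longrightarrow> strict_mono_on {0<..} (\<lambda>l. \<bar>G l\<bar>) \<longrightarrow>
     (\<forall>x\<in>einterval a b. \<forall>c\<in>einterval a b.
        ereal \<bar>f x\<bar> \<le> abs_inv G (G_bound q a b g (G (f c)) \<bar>x - c\<bar>)) \<and>
     (\<forall>a' b' :: real. a = ereal a' \<longrightarrow> b = ereal b' \<longrightarrow>
        (\<forall>x\<in>einterval a b. \<forall>c\<in>einterval a b.
           ereal \<bar>f x\<bar> \<le> abs_inv G (G_bound q a b g (G (f c)) (max \<bar>c - a'\<bar> \<bar>b' - c\<bar>))))) \<and>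
    (\<forall>a' :: real. a = ereal a' \<longrightarrow> constant_sign_on {0<..} G \<longrightarrow>
       strict_mono_on {0<..} (\<lambda>l. \<bar>G l\<bar>) \<longrightarrow> filterlim (\<lambda>r. \<bar>G r\<bar>) at_top at_top \<longrightarrow>
       (\<exists>ft. continuous_on (insert a' (einterval a b)) ft \<and> (\<forall>x\<in>einterval a b. ft x = f x) \<and>
         (\<forall>x\<in>einterval a b.
            ereal \<bar>f x\<bar> \<le> abs_inv G (G_bound q a b g (G_ext0 G (ft a')) \<bar>x - a'\<bar>)))) \<and>
    (\<forall>b' :: real. b = ereal b' \<longrightarrow> constant_sign_on {0<..} G \<longrightarrow>
       strict_mono_on {0<..} (\<lambda>l. \<bar>G l\<bar>) \<longrightarrow> filterlim (\<lambda>r. \<bar>G r\<bar>) at_top at_top \<longrightarrow>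
       (\<exists>ft. continuous_on (insert b' (einterval a b)) ft \<and> (\<forall>x\<in>einterval a b. ft x = f x) \<and>
         (\<forall>x\<in>einterval a b.
            ereal \<bar>f x\<bar> \<le> abs_inv G (G_bound q a b g (G_ext0 G (ft b')) \<bar>b' - x\<bar>)))) \<and>
    (\<forall>a' :: real. a = ereal a' \<longrightarrow> mono_on {0<..} G \<or> antimono_on {0<..} G \<longrightarrow>
       proper_tau_G_inv \<tau> G \<longrightarrow>
       (\<forall>x\<in>einterval a b. W2q_on q {a'<..<x} f \<and>
          (\<forall>c\<in>{a'<..<x}.
             (LINT t:{a'<..<x}|lebesgue. \<bar>deriv (deriv f) t\<bar> powr q) powr (1 / q)
             \<le> sup_tau_G_inv \<tau> G (G_bound q a b g (G (f c)) (max \<bar>c - a'\<bar> \<bar>x - c\<bar>))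
               * (LINT t:{a'<..<x}|lebesgue. \<bar>g t\<bar> powr q) powr (1 / q))) \<and>
       (\<forall>b' :: real. b = ereal b' \<longrightarrow> W2q_on q {a'<..<b'} f \<and>
          (\<forall>c\<in>{a'<..<b'}.
             (LINT t:{a'<..<b'}|lebesgue. \<bar>deriv (deriv f) t\<bar> powr q) powr (1 / q)
             \<le> sup_tau_G_inv \<tau> G (G_bound q a b g (G (f c)) (max \<bar>c - a'\<bar> \<bar>b' - c\<bar>))
               * (LINT t:{a'<..<b'}|lebesgue. \<bar>g t\<bar> powr q) powr (1 / q))))"
proof -
  have tr: "(\<forall>l>0. (H_tr q \<tau> K has_real_derivative h_tr q \<tau> K l) (at l) \<and> h_tr q \<tau> K l > 0 \<and>
      \<tau> l * \<bar>H_tr q \<tau> K l\<bar> = h_tr q \<tau> K l powr (1 - 1 / q)) \<and> continuous_on {0<..} (h_tr q \<tau> K)"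
  proof (cases "q = 1")
    case True
    then show ?thesis
      using transforms_q_eq_1[where \<tau> = \<tau> and K = K] \<tau>_pos \<tau>_q_eq_1 by auto
  next
    case False
    then have "q > 1" using q by simp
    then show ?thesis
      using transforms_q_gt_1[where q = q and \<tau> = \<tau> and K = K] \<tau>_pos \<tau>_cont K by auto
  qed
  have hcont: "continuous_on {0<..} (\<lambda>l. h_tr q \<tau> K l powr (1 / (2 * q)))"
  proof -
    have "h_tr q \<tau> K l \<noteq> 0" if "l > 0" for l using tr that by (metis less_irrefl)
    then show ?thesis using tr by (intro continuous_on_powr continuous_intros) auto
  qed
  interpret transformed_ode q a b g \<tau> "h_tr q \<tau> K" "H_tr q \<tau> K" G f
  proof
    show "(G has_real_derivative h_tr q \<tau> K l powr (1 / (2 * q))) (at l)" if "l > 0" for l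
      using ac_primitive_on_continuous_imp_DERIV[OF G _ hcont] that by simp
  qed (use assms tr in auto)
  have i: "set_integrable lebesgue (einterval a b) (\<lambda>x. \<bar>deriv f x\<bar> powr (2 * q) * h_tr q \<tau> K (f x))"
    "(LINT x:einterval a b|lebesgue. \<bar>deriv f x\<bar> powr (2 * q) * h_tr q \<tau> K (f x))
       \<le> sqrt (2 * q - 1) powr (2 * q) * (LINT x:einterval a b|lebesgue. \<bar>g x\<bar> powr q)"
  proof -
    have "sqrt (2 * q - 1) powr (2 * q) = (2 * q - 1) powr q"
      using q by (simp add: powr_half_sqrt[symmetric] powr_powr)
    then show "set_integrable lebesgue (einterval a b) (\<lambda>x. \<bar>deriv f x\<bar> powr (2 * q) * h_tr q \<tau> K (f x))"
      "(LINT x:einterval a b|lebesgue. \<bar>deriv f x\<bar> powr (2 * q) * h_tr q \<tau> K (f x))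
       \<le> sqrt (2 * q - 1) powr (2 * q) * (LINT x:einterval a b|lebesgue. \<bar>g x\<bar> powr q)"
      using energy_bound by (simp_all add: E_def[abs_def] Q_def)
  qed
  have ii: "hoelder_continuous_on (1 - 1 / (2 * q)) (einterval a b) (\<lambda>x. G (f x))"
    unfolding hoelder_continuous_on_def
    using G_f_hoelder by (intro exI[of _ "hoelder_const q a b g"]) (simp add: mult.commute)
  have ii': "(SUP (x, y) \<in> {(x, y). x \<in> einterval a b \<and> y \<in> einterval a b \<and> x \<noteq> y}.
         ereal (\<bar>G (f x) - G (f y)\<bar> / \<bar>x - y\<bar> powr (1 - 1 / (2 * q))))
       \<le> ereal (sqrt (2 * q - 1) *
           (LINT x:einterval a b|lebesgue. \<bar>g x\<bar> powr q) powr (1 / (2 * q)))"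
    unfolding hoelder_const_def[symmetric]
  proof (rule SUP_least, clarify)
    fix x y assume xy: "x \<in> einterval a b" "y \<in> einterval a b" "x \<noteq> y"
    then show "ereal (\<bar>G (f x) - G (f y)\<bar> / \<bar>x - y\<bar> powr (1 - 1 / (2 * q))) \<le> ereal (hoelder_const q a b g)"
      using G_f_hoelder[OF xy(1,2)] by (simp add: pos_divide_le_eq mult.commute)
  qed
  have iii: "ereal \<bar>f x\<bar> \<le> abs_inv G (G_bound q a b g (G (f c)) d)"
    if "strict_mono_on {0<..} (\<lambda>l. \<bar>G l\<bar>)" "x \<in> einterval a b" "c \<in> einterval a b" "\<bar>x - c\<bar> \<le> d" for x c d
    using that by (intro le_abs_inv[OF G_cont] f_pos abs_G_f_le)
  have iii': "\<bar>x - c\<bar> \<le> max \<bar>c - a'\<bar> \<bar>b' - c\<bar>"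
    if "a = ereal a'" "b = ereal b'" "x \<in> einterval a b" "c \<in> einterval a b" for x c a' b'
    using that by (auto simp: einterval_iff)
  obtain x0 where x0: "x0 \<in> einterval a b" using einterval_nonempty[OF ab] by blast
  have below_b: "ereal y < b" if "y < x" "ereal x < b" for x y
    using that less_trans[of "ereal y" "ereal x" b] by simp
  have above_a: "a < ereal y" if "x < y" "a < ereal x" for x y
    using that less_trans[of a "ereal x" "ereal y"] by simp
  have iv_a: "a' islimpt einterval a b" "a' \<notin> einterval a b" if "a = ereal a'" for a'
  proof -
    have "a' < x0" "{a'<..<x0} \<subseteq> einterval a b"
      using below_b x0 that by (auto simp: einterval_iff)
    then show "a' islimpt einterval a b" using islimpt_greaterThanLessThan1 islimpt_subset by blast
  qed (use that in \<open>simp add: einterval_iff\<close>)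
  have iv_b: "b' islimpt einterval a b" "b' \<notin> einterval a b" if "b = ereal b'" for b'
  proof -
    have "x0 < b'" "{x0<..<b'} \<subseteq> einterval a b"
      using above_a x0 that by (auto simp: einterval_iff)
    then show "b' islimpt einterval a b" using islimpt_greaterThanLessThan2 islimpt_subset by blast
  qed (use that in \<open>simp add: einterval_iff\<close>)
  have v: "a' < x \<and> {a'<..<x} \<subseteq> einterval a b" if "a = ereal a'" "x \<in> einterval a b" for a' x
    using that below_b by (auto simp: einterval_iff)
  have v': "a' < b' \<and> {a'<..<b'} \<subseteq> einterval a b" if "a = ereal a'" "b = ereal b'" for a' b'
    using that ab by (auto simp: einterval_iff)
  show ?thesis
  proof (intro conjI)
    show "constant_sign_on {0<..} G \<longrightarrow> strict_mono_on {0<..} (\<lambda>l. \<bar>G l\<bar>) \<longrightarrow>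
     (\<forall>x\<in>einterval a b. \<forall>c\<in>einterval a b.
        ereal \<bar>f x\<bar> \<le> abs_inv G (G_bound q a b g (G (f c)) \<bar>x - c\<bar>)) \<and>
     (\<forall>a' b' :: real. a = ereal a' \<longrightarrow> b = ereal b' \<longrightarrow>
        (\<forall>x\<in>einterval a b. \<forall>c\<in>einterval a b.
           ereal \<bar>f x\<bar> \<le> abs_inv G (G_bound q a b g (G (f c)) (max \<bar>c - a'\<bar> \<bar>b' - c\<bar>))))"
      by (intro impI conjI ballI allI iii iii') auto
    show "\<forall>a' :: real. a = ereal a' \<longrightarrow> constant_sign_on {0<..} G \<longrightarrow>
       strict_mono_on {0<..} (\<lambda>l. \<bar>G l\<bar>) \<longrightarrow> filterlim (\<lambda>r. \<bar>G r\<bar>) at_top at_top \<longrightarrow>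
       (\<exists>ft. continuous_on (insert a' (einterval a b)) ft \<and> (\<forall>x\<in>einterval a b. ft x = f x) \<and>
         (\<forall>x\<in>einterval a b.
            ereal \<bar>f x\<bar> \<le> abs_inv G (G_bound q a b g (G_ext0 G (ft a')) \<bar>x - a'\<bar>)))"
      by (intro allI impI extension_to_endpoint iv_a) auto
    show "\<forall>b' :: real. b = ereal b' \<longrightarrow> constant_sign_on {0<..} G \<longrightarrow>
       strict_mono_on {0<..} (\<lambda>l. \<bar>G l\<bar>) \<longrightarrow> filterlim (\<lambda>r. \<bar>G r\<bar>) at_top at_top \<longrightarrow>
       (\<exists>ft. continuous_on (insert b' (einterval a b)) ft \<and> (\<forall>x\<in>einterval a b. ft x = f x) \<and>
         (\<forall>x\<in>einterval a b.
            ereal \<bar>f x\<bar> \<le> abs_inv G (G_bound q a b g (G_ext0 G (ft b')) \<bar>b' - x\<bar>)))"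
    proof (intro allI impI)
      fix b' assume b': "b = ereal b'" and G': "constant_sign_on {0<..} G"
        "strict_mono_on {0<..} (\<lambda>l. \<bar>G l\<bar>)" "filterlim (\<lambda>r. \<bar>G r\<bar>) at_top at_top"
      show "\<exists>ft. continuous_on (insert b' (einterval a b)) ft \<and> (\<forall>x\<in>einterval a b. ft x = f x) \<and>
         (\<forall>x\<in>einterval a b.
            ereal \<bar>f x\<bar> \<le> abs_inv G (G_bound q a b g (G_ext0 G (ft b')) \<bar>b' - x\<bar>))"
        using extension_to_endpoint[OF iv_b[OF b'] G'] by (simp only: abs_minus_commute[of _ b'])
    qed
    show "\<forall>a' :: real. a = ereal a' \<longrightarrow> mono_on {0<..} G \<or> antimono_on {0<..} G \<longrightarrow>
       proper_tau_G_inv \<tau> G \<longrightarrow>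
       (\<forall>x\<in>einterval a b. W2q_on q {a'<..<x} f \<and>
          (\<forall>c\<in>{a'<..<x}.
             (LINT t:{a'<..<x}|lebesgue. \<bar>deriv (deriv f) t\<bar> powr q) powr (1 / q)
             \<le> sup_tau_G_inv \<tau> G (G_bound q a b g (G (f c)) (max \<bar>c - a'\<bar> \<bar>x - c\<bar>))
               * (LINT t:{a'<..<x}|lebesgue. \<bar>g t\<bar> powr q) powr (1 / q))) \<and>
       (\<forall>b' :: real. b = ereal b' \<longrightarrow> W2q_on q {a'<..<b'} f \<and>
          (\<forall>c\<in>{a'<..<b'}.
             (LINT t:{a'<..<b'}|lebesgue. \<bar>deriv (deriv f) t\<bar> powr q) powr (1 / q)
             \<le> sup_tau_G_inv \<tau> G (G_bound q a b g (G (f c)) (max \<bar>c - a'\<bar> \<bar>b' - c\<bar>))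
               * (LINT t:{a'<..<b'}|lebesgue. \<bar>g t\<bar> powr q) powr (1 / q)))"
    proof (intro allI impI conjI ballI[where A = "einterval a b"])
      fix a' assume a': "a = ereal a'" and proper: "proper_tau_G_inv \<tau> G"
      show "W2q_on q {a'<..<x} f" if "x \<in> einterval a b" for x
        using second_derivative_bound[OF proper] v[OF a' that] by blast
      show "\<forall>c\<in>{a'<..<x}.
             (LINT t:{a'<..<x}|lebesgue. \<bar>deriv (deriv f) t\<bar> powr q) powr (1 / q)
             \<le> sup_tau_G_inv \<tau> G (G_bound q a b g (G (f c)) (max \<bar>c - a'\<bar> \<bar>x - c\<bar>))
               * (LINT t:{a'<..<x}|lebesgue. \<bar>g t\<bar> powr q) powr (1 / q)" if "x \<in> einterval a b" for x
        using second_derivative_bound[OF proper] v[OF a' that] by blast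
      show "W2q_on q {a'<..<b'} f" if "b = ereal b'" for b'
        using second_derivative_bound[OF proper] v'[OF a' that] by blast
      show "\<forall>c\<in>{a'<..<b'}.
             (LINT t:{a'<..<b'}|lebesgue. \<bar>deriv (deriv f) t\<bar> powr q) powr (1 / q)
             \<le> sup_tau_G_inv \<tau> G (G_bound q a b g (G (f c)) (max \<bar>c - a'\<bar> \<bar>b' - c\<bar>))
               * (LINT t:{a'<..<b'}|lebesgue. \<bar>g t\<bar> powr q) powr (1 / q)" if "b = ereal b'" for b'
        using second_derivative_bound[OF proper] v'[OF a' that] by blast
    qed
  qed (fact i ii ii')+
qed

end
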